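(* Let $h : S_1 \to S_1$ be an orientation preserving homeomorphism that fixes the point $0\in S_1$, and assume that $h\nu_2 h^{-1}$ and $h^{-1}\nu_2 h$ are both in $\overline{T}_{2,1}$. Then $h \in T_{2,1}$.
   Context: $S_1=\mathbf{R}/\mathbf{Z}$; linearity, slope, etc. of functions on $S_1$ are understood exactly as on $\mathbf{R}$. $\mathbf{Z}[\frac12]$ denotes the set of points of $S_1$ represented by numbers $a2^b$, $a,b\in\mathbf{Z}$. The map $\nu_2:S_1\to S_1$ is $\nu_2(x)=2x$. A break of $f$ is a point of discontinuity of $f'$. A continuous function is piecewise linear (PL) if each point of its domain has an open neighborhood on which it is at most the only break. $T_{2,1}$ is the group of homeomorphisms $f:S_1\to S_1$ such that: (1) $f$ is PL; (2) $f$ is orientation preserving; (3) all slopes of $f$ are integral powers of $2$; (4) the breaks of $f$ lie in a discrete subset of $\mathbf{Z}[\frac12]$; (5) $f(\mathbf{Z}[\frac12])\subseteq\mathbf{Z}[\frac12]$. $\overline T_{2,1}$ is the monoid of functions $f$ whose domain and range are open subsets of $S_1$ and which satisfy (1)–(5), where (2) is interpreted locally (so $f$ is a local homeomorphism, not necessarily injective), (4) requires the breaks to lie in $\mathbf{Z}[\frac12]$ and be discrete in the domain of $f$, and (5) applies to points of $\mathbf{Z}[\frac12]$ in the domain; for instance $\nu_2\in\overline T_{2,1}$. *)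

theory Defs
  imports "HOL-Analysis.Analysis"
begin

section \<open>The circle\<close>

quotient_type circle = real / "\<lambda>x y :: real. x - y \<in> \<int>"
  morphisms rep_circle circle_of
proof (intro equivpI reflpI sympI transpI)
  show "x - y \<in> \<int> \<Longrightarrow> y - x \<in> \<int>" for x y :: real
    using Ints_minus by fastforce
  show "x - y \<in> \<int> \<Longrightarrow> y - z \<in> \<int> \<Longrightarrow> x - z \<in> \<int>" for x y z :: real
    using Ints_add by fastforce
qed simp

lemma circle_of_eq_iff: "circle_of x = circle_of y \<longleftrightarrow> x - y \<in> \<int>"
  by (rule circle.abs_eq_iff)

instantiation circle :: topological_space
begin

definition open_circle :: "circle set \<Rightarrow> bool" where
  "open_circle U \<longleftrightarrow> open (circle_of -` U)"

instance
proof
  show "open (UNIV :: circle set)"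
    by (simp add: open_circle_def)
  show "open S \<Longrightarrow> open T \<Longrightarrow> open (S \<inter> T)" for S T :: "circle set"
    by (simp add: open_circle_def open_Int)
  show "\<forall>S\<in>K. open S \<Longrightarrow> open (\<Union>K)" for K :: "circle set set"
    by (auto simp: open_circle_def vimage_Union intro!: open_UN)
qed

end

definition dyadic_points :: "circle set" where
  "dyadic_points = {circle_of (of_int a * 2 powi b) | a b :: int. True}"

lift_definition nu2 :: "circle \<Rightarrow> circle" is "\<lambda>x. 2 * x"
  by (metis Ints_mult Ints_numeral right_diff_distrib)


section \<open>Slopes and breaks\<close>

text \<open>
  Slopes are computed in local coordinates: near \<open>t\<close> the map \<open>f\<close> is written as
  \<open>circle_of s \<mapsto> circle_of (g s)\<close>. The result does not depend on \<open>t\<close> and \<open>g\<close>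
  (\<open>has_slope_unique\<close> below).
\<close>

definition has_slope :: "(circle \<Rightarrow> circle) \<Rightarrow> real \<Rightarrow> circle \<Rightarrow> bool" where
  "has_slope f D p \<longleftrightarrow>
     (\<exists>t g. circle_of t = p \<and>
            (\<forall>\<^sub>F s in nhds t. f (circle_of s) = circle_of (g s)) \<and>
            (g has_real_derivative D) (at t))"

lemma has_slope_unique:
  assumes "has_slope f D p" "has_slope f E p"
  shows "D = E"
proof -
  obtain t g where t: "circle_of t = p" "\<forall>\<^sub>F s in nhds t. f (circle_of s) = circle_of (g s)"
      "(g has_real_derivative D) (at t)"
    using assms(1) by (auto simp: has_slope_def)
  obtain u k where u: "circle_of u = p" "\<forall>\<^sub>F s in nhds u. f (circle_of s) = circle_of (k s)"
      "(k has_real_derivative E) (at u)"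
    using assms(2) by (auto simp: has_slope_def)
  define n where "n = u - t"
  have n: "n \<in> \<int>" using t(1) u(1) circle_of_eq_iff[of u t] by (simp add: n_def)
  have un: "u = t + n" by (simp add: n_def)
  have k': "((\<lambda>s. k (s + n)) has_real_derivative E) (at t)"
    using u(3) unfolding un by (simp add: DERIV_shift)
  have "filterlim (\<lambda>s. s + n) (nhds (t + n)) (nhds t)"
    by (intro tendsto_intros filterlim_ident)
  from eventually_compose_filterlim[OF u(2)[unfolded un] this]
  have ev2: "\<forall>\<^sub>F s in nhds t. f (circle_of (s + n)) = circle_of (k (s + n))" .
  define d where "d = (\<lambda>s. g s - k (s + n))"
  have dd: "(d has_real_derivative (D - E)) (at t)"
    unfolding d_def by (intro DERIV_diff t(3) k')
  have ev: "\<forall>\<^sub>F s in nhds t. d s \<in> \<int>"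
    using t(2) ev2
  proof eventually_elim
    case (elim s)
    have "circle_of (s + n) = circle_of s" using n by (simp add: circle_of_eq_iff)
    then show ?case using elim circle_of_eq_iff[of "g s" "k (s + n)"] by (simp add: d_def)
  qed
  have dt: "d t \<in> \<int>" using ev eventually_nhds_x_imp_x by blast
  have "isCont d t" using dd DERIV_isCont by blast
  then have "filterlim d (nhds (d t)) (nhds t)"
    by (simp add: isCont_def tendsto_at_iff_tendsto_nhds)
  then have "\<forall>\<^sub>F s in nhds t. dist (d s) (d t) < 1" by (rule tendstoD) simp
  with ev have ev3: "\<forall>\<^sub>F s in nhds t. d s = d t"
    by eventually_elim (use dt in \<open>simp add: dist_real_def Ints_eq_abs_less1[of "d _" "d t"]\<close>)
  have "(d has_real_derivative 0) (at t)"
    using DERIV_cong_ev[OF refl ev3 refl] DERIV_const by blast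
  with dd have "D - E = 0" using DERIV_unique by blast
  then show ?thesis by simp
qed

definition has_some_slope :: "(circle \<Rightarrow> circle) \<Rightarrow> circle \<Rightarrow> bool" where
  "has_some_slope f p \<longleftrightarrow> (\<exists>D. has_slope f D p)"

definition slope :: "(circle \<Rightarrow> circle) \<Rightarrow> circle \<Rightarrow> real" where
  "slope f p = (THE D. has_slope f D p)"

lemma slope_eq: "has_slope f D p \<Longrightarrow> slope f p = D"
  unfolding slope_def using has_slope_unique by blast

text \<open>
  In what follows \<open>U\<close> is the (open) domain of \<open>f\<close>; the values of \<open>f\<close> outside \<open>U\<close> are
  irrelevant. A point where \<open>f'\<close> does not exist counts as a point of discontinuity of \<open>f'\<close>.
\<close>

definition breaks :: "circle set \<Rightarrow> (circle \<Rightarrow> circle) \<Rightarrow> circle set" where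
  "breaks U f =
     {p \<in> U. \<not> (has_some_slope f p \<and>
        (slope f \<longlongrightarrow> slope f p) (at p within {q \<in> U. has_some_slope f q}))}"

text \<open>
  This definition says nothing about linearity between the breaks. In the definitions below
  that linearity comes from the requirement that all slopes are powers of 2: off the breaks
  \<open>f'\<close> is then continuous with values in a discrete subset of the positive reals, hence
  locally constant.
\<close>

definition piecewise_linear :: "circle set \<Rightarrow> (circle \<Rightarrow> circle) \<Rightarrow> bool" where
  "piecewise_linear U f \<longleftrightarrow>
     continuous_on U f \<and>
     (\<forall>p\<in>U. \<exists>N. open N \<and> p \<in> N \<and> N \<subseteq> U \<and> breaks U f \<inter> N \<subseteq> {p})"

definition slopes_powers_of_2 :: "circle set \<Rightarrow> (circle \<Rightarrow> circle) \<Rightarrow> bool" where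
  "slopes_powers_of_2 U f \<longleftrightarrow>
     (\<forall>p\<in>U. \<forall>D. has_slope f D p \<longrightarrow> (\<exists>k::int. D = 2 powi k))"


section \<open>Orientation\<close>

definition circle_homeomorphism :: "(circle \<Rightarrow> circle) \<Rightarrow> bool" where
  "circle_homeomorphism f \<longleftrightarrow> (\<exists>g. homeomorphism UNIV UNIV f g)"

text \<open>For homeomorphisms of the whole circle: some lift to the real line is increasing.\<close>

definition orientation_preserving :: "(circle \<Rightarrow> circle) \<Rightarrow> bool" where
  "orientation_preserving f \<longleftrightarrow>
     (\<exists>F :: real \<Rightarrow> real. continuous_on UNIV F \<and> strict_mono F \<and>
        (\<forall>x. f (circle_of x) = circle_of (F x)))"

text \<open>
  The local version. It implies that \<open>f\<close> is a local homeomorphism on \<open>U\<close>, since a continuous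
  strictly increasing function on an open interval is a homeomorphism onto an open interval.
\<close>

definition locally_orientation_preserving :: "circle set \<Rightarrow> (circle \<Rightarrow> circle) \<Rightarrow> bool" where
  "locally_orientation_preserving U f \<longleftrightarrow>
     (\<forall>t. circle_of t \<in> U \<longrightarrow>
        (\<exists>e>0. \<exists>g :: real \<Rightarrow> real.
           continuous_on {t - e<..<t + e} g \<and> strict_mono_on {t - e<..<t + e} g \<and>
           (\<forall>s\<in>{t - e<..<t + e}. circle_of s \<in> U \<and> f (circle_of s) = circle_of (g s))))"


section \<open>The group and the monoid\<close>

definition T21 :: "(circle \<Rightarrow> circle) set" where
  "T21 = {f. circle_homeomorphism f \<and>
     piecewise_linear UNIV f \<and>
     orientation_preserving f \<and>
     slopes_powers_of_2 UNIV f \<and>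
     (\<exists>B. discrete B \<and> B \<subseteq> dyadic_points \<and> breaks UNIV f \<subseteq> B) \<and>
     f ` dyadic_points \<subseteq> dyadic_points}"

text \<open>Elements of the monoid are partial maps, given as pairs of a domain and a function.\<close>

definition T21_bar :: "(circle set \<times> (circle \<Rightarrow> circle)) set" where
  "T21_bar = {(U, f). open U \<and> open (f ` U) \<and>
     piecewise_linear U f \<and>
     locally_orientation_preserving U f \<and>
     slopes_powers_of_2 U f \<and>
     breaks U f \<subseteq> dyadic_points \<and> breaks U f sparse_in U \<and>
     f ` (dyadic_points \<inter> U) \<subseteq> dyadic_points}"

lemma nu2_in_T21_bar: "(UNIV, nu2) \<in> T21_bar"
proof -
  have ab: "nu2 (circle_of x) = circle_of (2 * x)" for x by (simp add: nu2.abs_eq)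
  have ex: "\<exists>t. circle_of t = p" for p by (metis Quotient3_abs_rep Quotient3_circle)
  have sl: "has_slope nu2 2 p" for p
  proof -
    obtain t where "circle_of t = p" using ex by blast
    moreover have "((\<lambda>s. 2 * s) has_real_derivative 2) (at t)"
      by (auto intro!: derivative_eq_intros)
    ultimately show ?thesis unfolding has_slope_def by (auto simp: ab intro!: exI[of _ t] exI[of _ "\<lambda>s. 2 * s"])
  qed
  have sf: "slope nu2 = (\<lambda>_. 2)" using slope_eq[OF sl] by blast
  have br: "breaks UNIV nu2 = {}"
    unfolding breaks_def sf using sl by (auto simp: breaks_def has_some_slope_def)
  have cont: "continuous_on UNIV nu2"
  proof -
    have "open (nu2 -` B)" if "open B" for B
    proof -
      have "circle_of -` (nu2 -` B) = (\<lambda>x. 2 * x) -` (circle_of -` B)" by (auto simp: ab)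
      moreover have "open \<dots>" 
      proof (rule open_vimage)
        show "open (circle_of -` B)" using that by (simp add: open_circle_def)
      qed (intro continuous_intros)
      ultimately show ?thesis by (simp add: open_circle_def)
    qed
    then show ?thesis by (simp add: continuous_on_open_vimage)
  qed
  have "surj nu2"
  proof (rule surjI[of _ "\<lambda>p. circle_of (rep_circle p / 2)"])
    show "nu2 (circle_of (rep_circle p / 2)) = p" for p
      by (simp add: ab Quotient3_abs_rep[OF Quotient3_circle])
  qed
  moreover have "locally_orientation_preserving UNIV nu2"
    unfolding locally_orientation_preserving_def
    by (auto simp: ab intro!: exI[of _ 1] exI[of _ "\<lambda>s. 2 * s"] continuous_intros strict_mono_onI)
  moreover have "slopes_powers_of_2 UNIV nu2"
    unfolding slopes_powers_of_2_def using has_slope_unique[OF sl]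
    by (metis power_int_1_right)
  moreover have "nu2 ` dyadic_points \<subseteq> dyadic_points"
  proof -
    have "\<exists>a' b' :: int. circle_of (2 * (of_int a * 2 powi b)) = circle_of (of_int a' * 2 powi b')" for a b :: int
      by (rule exI[of _ "2*a"], rule exI[of _ b]) (simp add: mult.assoc)
    then show ?thesis unfolding dyadic_points_def by (auto simp: ab)
  qed
  ultimately show ?thesis
    by (auto simp: T21_bar_def piecewise_linear_def br cont intro: exI[of _ UNIV])
qed

end

(*
  Lift h to a homeomorphism H of the line fixing 0, with inverse G. Both H and G preserve the dyadic
  rationals, since h nu_2 h^-1 and h^-1 nu_2 h are piecewise affine over Z[1/2] and every dyadic
  rational is eventually mapped into Z by doubling. Up to scaling, the restriction of H (or G) to a
  short interval [v, v + 1] / 2^n depends only on finitely many low binary digits of v.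

  If for G it depends on no digit at all, G is linear near 0. Otherwise let N be the number of digits
  that matter; comparing the two values of the N-th digit shows that the shape of G on a short
  interval determines whether the interval is the left or the right half of its parent. For large n
  the map z |-> H (G z + 2^-n) preserves shapes, so it maps siblings to siblings, and merging siblings
  repeatedly shows that it has no breaks on a fixed interval [0, eta]. Thus
  H (x + 2^-n) = H (2^-n) + c_n H x for x near 0. Interchanging the roles of x = 2^-m and 2^-n and
  letting m tend to infinity forces c_n = 1, so H is linear near 0 with slope a power of 2. Since short
  intervals everywhere have the same shapes as short intervals near 0, H is piecewise linear.
*)
theory Submission
  imports Defs
begin

section \<open>Dyadic rationals and powers of 2\<close>

definition pow2 :: "real set" where
  "pow2 = range (\<lambda>k::int. 2 powi k)"

definition dyadics :: "real set" where
  "dyadics = {x. \<exists>n::nat. 2 ^ n * x \<in> \<int>}"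

lemma pow2_pos: "x \<in> pow2 \<Longrightarrow> 0 < x"
  by (auto simp: pow2_def)

lemma pow2_1 [simp]: "1 \<in> pow2"
  unfolding pow2_def by (rule image_eqI[of _ _ 0]) auto

lemma pow2_powi [simp]: "2 powi k \<in> pow2"
  by (auto simp: pow2_def)

lemma pow2_power [simp]: "2 ^ n \<in> pow2"
  using pow2_powi[of "int n"] by simp

lemma pow2_mult: "x \<in> pow2 \<Longrightarrow> y \<in> pow2 \<Longrightarrow> x * y \<in> pow2"
  unfolding pow2_def by (auto simp flip: power_int_add)

lemma pow2_inverse: "x \<in> pow2 \<Longrightarrow> inverse x \<in> pow2"
  unfolding pow2_def by (auto simp flip: power_int_minus)

lemma pow2_divide: "x \<in> pow2 \<Longrightarrow> y \<in> pow2 \<Longrightarrow> x / y \<in> pow2"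
  by (simp add: divide_inverse pow2_mult pow2_inverse)

lemma pow2_less_1: assumes "x \<in> pow2" "x < 1" shows "x \<le> 1/2"
proof -
  obtain k :: int where k: "x = 2 powi k" using assms by (auto simp: pow2_def)
  have "k < 0"
  proof (rule ccontr)
    assume "\<not> k < 0"
    then have "(2::real) powi 0 \<le> 2 powi k" by (intro power_int_increasing) auto
    then show False using assms k by simp
  qed
  then have "2 powi k \<le> (2::real) powi (-1)"
    by (intro power_int_increasing) auto
  then show ?thesis by (simp add: k)
qed

lemma pow2_greater_1: assumes "x \<in> pow2" "1 < x" shows "2 \<le> x"
proof -
  have "inverse x \<le> 1/2"
    using assms by (intro pow2_less_1 pow2_inverse) (auto simp: field_simps)
  then show ?thesis using assms by (simp add: field_simps)
qed

text \<open>Both summands are positive, so each is below 1 and therefore at most 1/2.\<close>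

lemma pow2_sum_1:
  assumes "x \<in> pow2" "y \<in> pow2" "x + y = 1"
  shows "x = 1/2" "y = 1/2"
  using pow2_less_1[of x] pow2_less_1[of y] pow2_pos[of x] pow2_pos[of y] assms by auto

text \<open>Discreteness in quantitative form: it excludes factors near 1 other than 1, and makes
  continuous slope functions locally constant.\<close>

lemma pow2_gap: "x \<in> pow2 \<Longrightarrow> x \<noteq> 1 \<Longrightarrow> 1/2 \<le> \<bar>x - 1\<bar>"
  using pow2_less_1[of x] pow2_greater_1[of x] by linarith

text \<open>Phrased with \<open>eventually\<close> so that finitely many dyadic rationals obtain a
  common denominator.\<close>

lemma dyadics_level:
  assumes "x \<in> dyadics"
  shows "eventually (\<lambda>n. 2 ^ n * x \<in> \<int>) sequentially"
proof -
  obtain m where m: "2 ^ m * x \<in> \<int>" using assms by (auto simp: dyadics_def)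
  have "2 ^ n * x \<in> \<int>" if "n \<ge> m" for n
  proof -
    have "(2::real) ^ n = 2 ^ (n - m) * 2 ^ m" using that by (simp flip: power_add)
    then have "2 ^ n * x = 2 ^ (n - m) * (2 ^ m * x)" by (simp only: mult.assoc)
    moreover have "\<dots> \<in> \<int>" by (rule Ints_mult[OF _ m]) simp
    ultimately show ?thesis by (simp only:)
  qed
  then show ?thesis by (auto simp: eventually_sequentially)
qed

lemma dyadics_add: assumes "x \<in> dyadics" "y \<in> dyadics" shows "x + y \<in> dyadics"
proof -
  have "eventually (\<lambda>n. 2 ^ n * (x + y) \<in> \<int>) sequentially"
    using dyadics_level[OF assms(1)] dyadics_level[OF assms(2)]
    by eventually_elim (simp add: distrib_left)
  then show ?thesis by (auto simp: dyadics_def eventually_sequentially)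
qed

lemma dyadics_minus: "x \<in> dyadics \<Longrightarrow> - x \<in> dyadics"
  by (auto simp: dyadics_def)

lemma dyadics_diff: "x \<in> dyadics \<Longrightarrow> y \<in> dyadics \<Longrightarrow> x - y \<in> dyadics"
  using dyadics_add[of x "-y"] dyadics_minus by simp

lemma dyadics_mult: assumes "x \<in> dyadics" "y \<in> dyadics" shows "x * y \<in> dyadics"
proof -
  obtain m n where "2 ^ m * x \<in> \<int>" "2 ^ n * y \<in> \<int>" using assms by (auto simp: dyadics_def)
  then have "2 ^ (m + n) * (x * y) \<in> \<int>"
    using Ints_mult[of "2 ^ m * x" "2 ^ n * y"] by (simp add: power_add mult_ac)
  then show ?thesis by (auto simp: dyadics_def)
qed

lemma dyadics_Ints: "x \<in> \<int> \<Longrightarrow> x \<in> dyadics"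
  unfolding dyadics_def by (auto intro!: exI[of _ 0])

lemma dyadics_frac [simp]: "of_int v / 2 ^ n \<in> dyadics"
  unfolding dyadics_def by (auto intro!: exI[of _ n])

lemma dyadicsE:
  assumes "x \<in> dyadics"
  obtains v n where "x = of_int v / 2 ^ n"
proof -
  obtain n where "2 ^ n * x \<in> \<int>" using assms by (auto simp: dyadics_def)
  then obtain v where "2 ^ n * x = of_int v" by (auto elim: Ints_cases)
  then have "x = of_int v / 2 ^ n" by (simp add: field_simps)
  then show thesis by (rule that)
qed

lemma pow2_dyadics: assumes "x \<in> pow2" shows "x \<in> dyadics"
proof -
  obtain k :: int where k: "x = 2 powi k" using assms by (auto simp: pow2_def)
  have "2 ^ nat \<bar>k\<bar> * x \<in> \<int>"
  proof (cases "k \<ge> 0")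
    case True
    then show ?thesis by (simp add: k power_int_def)
  next
    case False
    then have "2 ^ nat \<bar>k\<bar> * x = 1" by (simp add: k power_int_def field_simps)
    then show ?thesis by simp
  qed
  then show ?thesis by (auto simp: dyadics_def)
qed

text \<open>The positive units of the ring Z[1/2]: after clearing denominators, \<open>a\<close>
  divides a power of 2.\<close>

lemma dyadics_unit:
  assumes "0 < s" "s \<in> dyadics" "inverse s \<in> dyadics"
  shows "s \<in> pow2"
proof -
  obtain a m where a: "s = of_int a / 2 ^ m" using dyadicsE[OF assms(2)] by blast
  obtain b n where b: "inverse s = of_int b / 2 ^ n" using dyadicsE[OF assms(3)] by blast
  have "a > 0" using a assms(1) by (simp add: zero_less_divide_iff)
  have "of_int (a * b) = (of_int (2 ^ (m + n)) :: real)"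
    using a b assms(1) by (simp add: field_simps power_add)
  then have "a * b = 2 ^ (m + n)" using of_int_eq_iff by blast
  then have "nat a dvd 2 ^ (m + n)"
    using \<open>a > 0\<close> by (metis dvd_triv_left int_dvd_int_iff int_nat_eq less_imp_le of_nat_numeral of_nat_power)
  then obtain i where "nat a = 2 ^ i"
    using divides_primepow_nat[OF two_is_prime_nat] by blast
  then have "a = 2 ^ i" using \<open>a > 0\<close> by (metis int_nat_eq less_imp_le of_nat_numeral of_nat_power)
  then show ?thesis using a by (simp add: pow2_divide)
qed

lemma inverse_pow2_le:
  fixes a :: real
  assumes "0 < a"
  obtains n0 where "\<And>n. n0 \<le> n \<Longrightarrow> 1 / 2 ^ n \<le> a"
proof -
  obtain n0 where n0: "(1/2) ^ n0 < a"
    using real_arch_pow_inv[of a "1/2"] assms by auto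
  have "1 / 2 ^ n \<le> a" if "n0 \<le> n" for n
  proof -
    have "(1/2::real) ^ n \<le> (1/2) ^ n0" using that by (intro power_decreasing) auto
    then show ?thesis using n0 by (simp add: power_one_over)
  qed
  then show thesis by (rule that)
qed

lemma frac_mod_pow:
  "real_of_int v / 2 ^ n = of_int (v mod 2 ^ n) / 2 ^ n + of_int (v div 2 ^ n)"
proof -
  have "real_of_int v = of_int (v mod 2 ^ n) + of_int (v div 2 ^ n * 2 ^ n)"
    by (simp only: mod_div_mult_eq flip: of_int_add)
  then show ?thesis by (simp add: field_simps)
qed

lemma add_of_int_of_add_1:
  fixes \<phi> :: "real \<Rightarrow> real"
  assumes per: "\<And>x. \<phi> (x + 1) = \<phi> x + 1"
  shows "\<phi> (x + of_int k) = \<phi> x + of_int k"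
proof (induction k rule: int_induct[of _ 0])
  case (step1 i)
  then show ?case using per[of "x + of_int i"] by (simp add: add_ac)
next
  case (step2 i)
  then show ?case using per[of "x + of_int (i - 1)"] by (simp add: algebra_simps)
qed simp

text \<open>Monotonicity replaces continuity: \<open>x\<close> lies between neighbours of the level
  \<open>n\<close> grid, whose values differ by \<open>s / 2 ^ n\<close>, and \<open>n\<close> is
  arbitrarily large.\<close>

lemma strict_mono_linear_on_dyadics:
  fixes \<phi> :: "real \<Rightarrow> real"
  assumes mono: "strict_mono \<phi>"
    and dyad: "\<And>n k. N \<le> n \<Longrightarrow> of_nat k / 2 ^ n \<le> (1 / 2 ^ N :: real)
      \<Longrightarrow> \<phi> (of_nat k / 2 ^ n) = s * (of_nat k / 2 ^ n)"
    and x: "0 \<le> x" "x \<le> 1 / 2 ^ N"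
  shows "\<phi> x = s * x"
proof (cases "x = 1 / 2 ^ N")
  case True
  then show ?thesis using dyad[of N 1] by simp
next
  case False
  have bound: "\<bar>\<phi> x - s * x\<bar> \<le> \<bar>s\<bar> * (1/2) ^ n" if n: "N \<le> n" for n
  proof -
    define k where "k = nat \<lfloor>2 ^ n * x\<rfloor>"
    have k: "real k \<le> 2 ^ n * x" "2 ^ n * x < real k + 1"
      using x by (auto simp: k_def)
    have lo: "real k / 2 ^ n \<le> x" and hi: "x \<le> real (Suc k) / 2 ^ n"
      using k by (auto simp: field_simps)
    have pow: "(2::real) ^ n / 2 ^ N = 2 ^ (n - N)" using n by (simp add: power_diff)
    \<comment> \<open>Strictness keeps the right neighbour \<open>Suc k / 2 ^ n\<close> inside the
      range covered by \<open>dyad\<close>.\<close>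
    have "2 ^ n * x < 2 ^ n / 2 ^ N" using False x by (simp add: field_simps)
    also note pow
    finally have "real k < 2 ^ (n - N)" using k(1) by linarith
    then have "Suc k \<le> 2 ^ (n - N)"
      by (metis Suc_le_eq of_nat_less_iff of_nat_numeral of_nat_power)
    then have "real (Suc k) \<le> 2 ^ n / 2 ^ N"
      unfolding pow by (metis of_nat_le_iff of_nat_numeral of_nat_power)
    then have le: "real (Suc k) / 2 ^ n \<le> 1 / 2 ^ N"
      by (simp add: field_simps)
    have "real k / 2 ^ n \<le> real (Suc k) / 2 ^ n" by (simp add: divide_right_mono)
    then have e: "\<phi> (real k / 2 ^ n) = s * (real k / 2 ^ n)"
        "\<phi> (real (Suc k) / 2 ^ n) = s * (real (Suc k) / 2 ^ n)"
      using dyad[OF n order_trans[OF _ le]] dyad[OF n le] by auto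
    have m: "s * (real k / 2 ^ n) \<le> \<phi> x" "\<phi> x \<le> s * (real (Suc k) / 2 ^ n)"
      using lo hi strict_mono_less_eq[OF mono] e by metis+
    have s: "s \<ge> 0"
    proof (rule ccontr)
      assume "\<not> ?thesis"
      then have "s * (real (Suc k) / 2 ^ n) < s * (real k / 2 ^ n)"
        by (intro mult_strict_left_mono_neg) (auto simp: divide_strict_right_mono)
      then show False using m by linarith
    qed
    have "s * (real k / 2 ^ n) \<le> s * x" "s * x \<le> s * (real (Suc k) / 2 ^ n)"
      by (intro mult_left_mono lo hi s)+
    then have "\<bar>\<phi> x - s * x\<bar> \<le> s * (real (Suc k) / 2 ^ n) - s * (real k / 2 ^ n)"
      using m by linarith
    also have "\<dots> = \<bar>s\<bar> * (1/2) ^ n" using s by (simp add: field_simps power_one_over)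
    finally show ?thesis .
  qed
  have "(\<lambda>n. \<bar>s\<bar> * (1/2) ^ n) \<longlonglongrightarrow> \<bar>s\<bar> * 0"
    by (intro tendsto_mult_left LIMSEQ_power_zero) auto
  then have "\<bar>\<phi> x - s * x\<bar> \<le> \<bar>s\<bar> * 0"
    by (rule tendsto_lowerbound) (use bound in \<open>auto simp: eventually_sequentially\<close>)
  then show ?thesis by simp
qed

section \<open>Similar dyadic intervals\<close>

text \<open>
  \<open>similar \<phi> n v n' v'\<close>: on the dyadic intervals \<open>[v, v + 1] / 2 ^ n\<close> and \<open>[v', v' + 1] / 2 ^ n'\<close>
  the graphs of \<open>\<phi>\<close> agree up to translation and scaling of both coordinates by powers of 2.
\<close>

definition similar :: "(real \<Rightarrow> real) \<Rightarrow> nat \<Rightarrow> int \<Rightarrow> nat \<Rightarrow> int \<Rightarrow> bool" where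
  "similar \<phi> n v n' v' \<longleftrightarrow> (\<exists>c\<in>pow2. \<forall>t\<in>{0..1}.
     \<phi> ((of_int v + t) / 2 ^ n) - \<phi> (of_int v / 2 ^ n) =
     c * (\<phi> ((of_int v' + t) / 2 ^ n') - \<phi> (of_int v' / 2 ^ n')))"

lemma similar_refl: "similar \<phi> n v n v"
  unfolding similar_def by (rule bexI[of _ 1]) auto

lemma similar_sym:
  assumes "similar \<phi> n v n' v'"
  shows "similar \<phi> n' v' n v"
proof -
  obtain c where c: "c \<in> pow2" "\<forall>t\<in>{0..1}. \<phi> ((of_int v + t) / 2 ^ n) - \<phi> (of_int v / 2 ^ n) =
     c * (\<phi> ((of_int v' + t) / 2 ^ n') - \<phi> (of_int v' / 2 ^ n'))"
    using assms by (auto simp: similar_def)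
  show ?thesis unfolding similar_def
    by (rule bexI[of _ "inverse c"]) (use c pow2_pos[of c] in \<open>auto simp: pow2_inverse\<close>)
qed

lemma similar_trans:
  assumes "similar \<phi> n v n' v'" "similar \<phi> n' v' n'' v''"
  shows "similar \<phi> n v n'' v''"
proof -
  obtain c where c: "c \<in> pow2" "\<forall>t\<in>{0..1}. \<phi> ((of_int v + t) / 2 ^ n) - \<phi> (of_int v / 2 ^ n) =
     c * (\<phi> ((of_int v' + t) / 2 ^ n') - \<phi> (of_int v' / 2 ^ n'))"
    using assms(1) by (auto simp: similar_def)
  obtain d where d: "d \<in> pow2" "\<forall>t\<in>{0..1}. \<phi> ((of_int v' + t) / 2 ^ n') - \<phi> (of_int v' / 2 ^ n') =
     d * (\<phi> ((of_int v'' + t) / 2 ^ n'') - \<phi> (of_int v'' / 2 ^ n''))"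
    using assms(2) by (auto simp: similar_def)
  show ?thesis unfolding similar_def
    by (rule bexI[of _ "c * d"]) (use c d in \<open>auto simp: pow2_mult\<close>)
qed

text \<open>The same \<open>k\<close> digits \<open>r\<close> are appended to both left endpoints.
  Subtracting the identity at the left end of the subinterval leaves the factor \<open>c\<close>
  unchanged.\<close>

lemma similar_sub:
  assumes "similar \<phi> n v n' v'" and r: "0 \<le> r" "r < 2 ^ k"
  shows "similar \<phi> (n + k) (2 ^ k * v + r) (n' + k) (2 ^ k * v' + r)"
proof -
  obtain c where c: "c \<in> pow2" "\<And>t. t \<in> {0..1} \<Longrightarrow> \<phi> ((of_int v + t) / 2 ^ n) - \<phi> (of_int v / 2 ^ n) =
     c * (\<phi> ((of_int v' + t) / 2 ^ n') - \<phi> (of_int v' / 2 ^ n'))"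
    using assms by (auto simp: similar_def)
  have eq: "(of_int (2 ^ k * u + r) + t) / 2 ^ (m + k) = (of_int u + (of_int r + t) / 2 ^ k) / 2 ^ m"
    for u m and t :: real
    by (simp add: field_simps power_add)
  have eq0: "of_int (2 ^ k * u + r) / 2 ^ (m + k) = (of_int u + of_int r / 2 ^ k) / (2 ^ m :: real)"
    for u m using eq[of u 0 m] by simp
  have "real_of_int (r + 1) \<le> of_int (2 ^ k)" using r(2) by (simp only: of_int_le_iff)
  then have "real_of_int r + 1 \<le> 2 ^ k" by simp
  then have in01: "(of_int r + t) / 2 ^ k \<in> {0..1}" if "t \<in> {0..1}" for t :: real
    using that r(1) by (auto simp: field_simps)
  show ?thesis unfolding similar_def
  proof (rule bexI[OF _ c(1)], rule ballI)
    fix t :: real assume t: "t \<in> {0..1}"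
    show "\<phi> ((of_int (2 ^ k * v + r) + t) / 2 ^ (n + k)) - \<phi> (of_int (2 ^ k * v + r) / 2 ^ (n + k)) =
      c * (\<phi> ((of_int (2 ^ k * v' + r) + t) / 2 ^ (n' + k)) - \<phi> (of_int (2 ^ k * v' + r) / 2 ^ (n' + k)))"
      using c(2)[OF in01[OF t]] c(2)[OF in01[of 0]] unfolding eq eq0
      by (simp add: algebra_simps)
  qed
qed

text \<open>
  Deep enough, no preimage of a break of \<open>A\<close> lies inside a dyadic interval, so doubling preserves
  the similarity class. Hence this class depends only on the last \<open>p\<close> binary digits of the left
  endpoint.
\<close>

lemma eventually_similar:
  fixes \<phi> \<psi> A :: "real \<Rightarrow> real"
  assumes mono: "strict_mono \<phi>"
    and inv: "\<And>x. \<phi> (\<psi> x) = x"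
    and per: "\<And>x. \<phi> (x + 1) = \<phi> x + 1"
    and conj: "\<And>x. \<phi> (2 * x) = A (\<phi> x)"
    and dyad: "\<And>x. x \<in> dyadics \<Longrightarrow> \<psi> x \<in> dyadics"
    and affine: "\<And>v::int. \<exists>c\<in>pow2. \<forall>x\<in>{of_int v / 2 ^ N..(of_int v + 1) / 2 ^ N}.
       \<forall>y\<in>{of_int v / 2 ^ N..(of_int v + 1) / 2 ^ N}. A x - A y = c * (x - y)"
  obtains p :: nat where "\<And>m n v w. p \<le> m \<Longrightarrow> p \<le> n \<Longrightarrow> 2 ^ p dvd v - w \<Longrightarrow> similar \<phi> m v n w"
proof -
  have perZ: "\<phi> (x + of_int k) = \<phi> x + of_int k" for x and k :: int
    using per by (rule add_of_int_of_add_1)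
  have perZ': "\<psi> (x + of_int k) = \<psi> x + of_int k" for x and k :: int
    using perZ[of "\<psi> x" k] inv strict_mono_eq[OF mono] by metis
  \<comment> \<open>One \<open>p\<close> clears the denominators of the preimages of all cell ends
    in one period; periodicity then covers every \<open>j\<close>.\<close>
  have "eventually (\<lambda>n. \<forall>j\<in>{0..<2 ^ N::int}. 2 ^ n * \<psi> (of_int j / 2 ^ N) \<in> \<int>) sequentially"
    by (intro eventually_ball_finite dyadics_level ballI dyad) auto
  then obtain p where p: "\<And>n j. p \<le> n \<Longrightarrow> j \<in> {0..<2 ^ N::int} \<Longrightarrow> 2 ^ n * \<psi> (of_int j / 2 ^ N) \<in> \<int>"
    unfolding eventually_sequentially by blast
  have int: "2 ^ n * \<psi> (of_int j / 2 ^ N) \<in> \<int>" if n: "n \<ge> p" for j :: int and n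
  proof -
    have "\<psi> (of_int j / 2 ^ N) = \<psi> (of_int (j mod 2 ^ N) / 2 ^ N) + of_int (j div 2 ^ N)"
      by (subst frac_mod_pow) (rule perZ')
    moreover have "2 ^ n * \<psi> (of_int (j mod 2 ^ N) / 2 ^ N) \<in> \<int>"
      using p[OF n] by simp
    ultimately show ?thesis by (simp add: distrib_left)
  qed
  have up: "similar \<phi> n v (Suc n) v" if n: "n \<ge> p" for n v
  proof -
    \<comment> \<open>The cell \<open>[j, j + 1] / 2 ^ N\<close> of \<open>A\<close> that contains
      the image of the left endpoint.\<close>
    define j where "j = \<lfloor>2 ^ N * \<phi> (of_int v / 2 ^ Suc n)\<rfloor>"
    obtain a where a: "2 ^ Suc n * \<psi> (of_int (j + 1) / 2 ^ N) = of_int a"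
      using int[of "Suc n" "j + 1"] n by (auto elim: Ints_cases)
    have jl: "of_int j \<le> 2 ^ N * \<phi> (of_int v / 2 ^ Suc n)"
      and jr: "2 ^ N * \<phi> (of_int v / 2 ^ Suc n) < of_int (j + 1)"
      by (auto simp: j_def)
    have "\<phi> (of_int v / 2 ^ Suc n) < \<phi> (\<psi> (of_int (j + 1) / 2 ^ N))"
      using jr unfolding inv by (simp add: field_simps)
    then have "of_int v / 2 ^ Suc n < \<psi> (of_int (j + 1) / 2 ^ N)"
      by (simp only: strict_mono_less[OF mono])
    \<comment> \<open>Both numbers are integers, so the strict bound improves to
      \<open>v + 1 \<le> a\<close>: the whole dyadic interval is mapped into one cell.\<close>
    then have "real_of_int v < of_int a" unfolding a[symmetric] by (simp add: field_simps)
    then have "real_of_int (v + 1) \<le> of_int a" by (simp only: of_int_le_iff of_int_less_iff)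
    then have le: "(of_int v + 1) / 2 ^ Suc n \<le> \<psi> (of_int (j + 1) / 2 ^ N)"
      unfolding a[symmetric] by (simp add: field_simps)
    have range: "\<phi> ((of_int v + t) / 2 ^ Suc n) \<in> {of_int j / 2 ^ N..(of_int j + 1) / 2 ^ N}"
      if t: "t \<in> {0..1}" for t
    proof -
      have "(of_int v + t) / 2 ^ Suc n \<le> \<psi> (of_int (j + 1) / 2 ^ N)"
        using le t by (auto simp: field_simps)
      then have "\<phi> ((of_int v + t) / 2 ^ Suc n) \<le> \<phi> (\<psi> (of_int (j + 1) / 2 ^ N))"
        by (simp only: strict_mono_less_eq[OF mono])
      moreover have "\<phi> (of_int v / 2 ^ Suc n) \<le> \<phi> ((of_int v + t) / 2 ^ Suc n)"
        using t by (simp only: strict_mono_less_eq[OF mono]) (simp add: field_simps)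
      moreover have "of_int j / 2 ^ N \<le> \<phi> (of_int v / 2 ^ Suc n)"
        using jl by (simp add: field_simps)
      ultimately show ?thesis by (simp add: inv)
    qed
    obtain c where c: "c \<in> pow2" "\<And>x y. x \<in> {of_int j / 2 ^ N..(of_int j + 1) / 2 ^ N} \<Longrightarrow>
        y \<in> {of_int j / 2 ^ N..(of_int j + 1) / 2 ^ N} \<Longrightarrow> A x - A y = c * (x - y)"
      using affine[of j] by blast
    have dbl: "\<phi> ((of_int v + t) / 2 ^ n) = A (\<phi> ((of_int v + t) / 2 ^ Suc n))" for t
    proof -
      have "(of_int v + t) / 2 ^ n = 2 * ((of_int v + t) / 2 ^ Suc n)"
        by (simp add: field_simps)
      then show ?thesis by (simp only: conj)
    qed
    show ?thesis unfolding similar_def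
      using c range[of 0] range dbl dbl[of 0] by (intro bexI[OF _ c(1)]) auto
  qed
  have up': "similar \<phi> p v m v" if "m \<ge> p" for m v
    using that by (induction m rule: dec_induct) (auto intro: similar_refl similar_trans up)
  have "similar \<phi> m v n w" if "p \<le> m" "p \<le> n" "2 ^ p dvd v - w" for m n v w
  proof -
    obtain k where k: "v - w = 2 ^ p * k" using \<open>2 ^ p dvd v - w\<close> by blast
    have shift: "(of_int v + t) / 2 ^ p = (of_int w + t) / 2 ^ p + of_int k" for t :: real
    proof -
      have "real_of_int v = of_int w + 2 ^ p * of_int k"
        using arg_cong[OF k, of real_of_int] by simp
      then show ?thesis by (simp add: field_simps)
    qed
    \<comment> \<open>At level \<open>p\<close> the two intervals are translates by the integer
      \<open>k\<close>, so periodicity gives the factor 1.\<close>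
    have "similar \<phi> p v p w"
      unfolding similar_def
      by (rule bexI[of _ 1]) (use shift shift[of 0] perZ in auto)
    then show ?thesis using up'[OF that(1)] up'[OF that(2)] similar_trans similar_sym by meson
  qed
  then show thesis by (rule that)
qed


section \<open>Linearity near the fixed point\<close>

text \<open>\<open>H\<close> models the lift of \<open>h\<close> and \<open>G\<close> its inverse;
  \<open>p\<close> and \<open>q\<close> are numbers of low digits that determine their similarity
  classes, and also the levels from which this holds.\<close>

locale dyadic_conjugacy =
  fixes H G :: "real \<Rightarrow> real" and p q :: nat
  assumes mono: "strict_mono H"
    and HG [simp]: "\<And>x. H (G x) = x"
    and GH [simp]: "\<And>x. G (H x) = x"
    and H_0 [simp]: "H 0 = 0"
    and H_1 [simp]: "H 1 = 1"
    and H_dyadics: "\<And>x. x \<in> dyadics \<Longrightarrow> H x \<in> dyadics"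
    and G_dyadics: "\<And>x. x \<in> dyadics \<Longrightarrow> G x \<in> dyadics"
    and H_similar: "\<And>m n v w. p \<le> m \<Longrightarrow> p \<le> n \<Longrightarrow> 2 ^ p dvd v - w \<Longrightarrow> similar H m v n w"
    and G_similar: "\<And>m n v w. q \<le> m \<Longrightarrow> q \<le> n \<Longrightarrow> 2 ^ q dvd v - w \<Longrightarrow> similar G m v n w"
begin

lemma G_mono: "strict_mono G"
  by (rule strict_monoI) (metis HG mono strict_mono_less)

lemma G_0 [simp]: "G 0 = 0"
  by (metis GH H_0)

lemma G_1 [simp]: "G 1 = 1"
  by (metis GH H_1)

lemma H_pos: "0 < x \<Longrightarrow> 0 < H x"
  using strict_monoD[OF mono, of 0 x] by simp

lemma G_pos: "0 < x \<Longrightarrow> 0 < G x"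
  using strict_monoD[OF G_mono, of 0 x] by simp

lemma G_le: "G x \<le> G y \<longleftrightarrow> x \<le> y"
  by (rule strict_mono_less_eq[OF G_mono])

lemma H_le: "H x \<le> H y \<longleftrightarrow> x \<le> y"
  by (rule strict_mono_less_eq[OF mono])

text \<open>The increments of \<open>G\<close> over an interval and its halves have ratios in
  \<open>pow2\<close>. The halves add up to the whole, so \<open>pow2_sum_1\<close> makes them
  equal; thus \<open>G\<close> is linear near 0, and so is its inverse \<open>H\<close>.\<close>

lemma linear_of_all_similar:
  assumes all: "\<And>m n v w. q \<le> m \<Longrightarrow> q \<le> n \<Longrightarrow> similar G m v n w"
  obtains N s where "0 < s" "\<And>x. 0 \<le> x \<Longrightarrow> x \<le> 1 / 2 ^ N \<Longrightarrow> H x = s * x"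
proof -
  define D where "D n v = G ((of_int v + 1) / 2 ^ n) - G (of_int v / 2 ^ n)" for n and v :: int
  have D_pos: "D n v > 0" for n v
    unfolding D_def using strict_monoD[OF G_mono] by (simp add: divide_strict_right_mono)
  have scale: "\<exists>c\<in>pow2. D m v = c * D n w" if "q \<le> m" "q \<le> n" for m n v w
    using all[OF that, of v w] unfolding similar_def D_def by fastforce
  have half: "D (Suc n) (2 * v) = D n v / 2 \<and> D (Suc n) (2 * v + 1) = D n v / 2" if n: "q \<le> n" for n v
  proof -
    obtain a b where ab: "a \<in> pow2" "D (Suc n) (2 * v) = a * D n v"
        "b \<in> pow2" "D (Suc n) (2 * v + 1) = b * D n v"
      using scale[of "Suc n" n "2 * v" v] scale[of "Suc n" n "2 * v + 1" v] n by auto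
    have eqs: "(real_of_int (2 * v + 1) + 1) / 2 ^ Suc n = (of_int v + 1) / 2 ^ n"
        "(real_of_int (2 * v) + 1) / 2 ^ Suc n = of_int (2 * v + 1) / 2 ^ Suc n"
        "real_of_int (2 * v) / 2 ^ Suc n = of_int v / 2 ^ n"
      by (auto simp: field_simps)
    have "D (Suc n) (2 * v) + D (Suc n) (2 * v + 1) = D n v"
      unfolding D_def eqs by simp
    then have "(a + b) * D n v = 1 * D n v" unfolding ab by (simp add: distrib_right)
    then have "a + b = 1" using D_pos[of n v] by simp
    then show ?thesis using pow2_sum_1[OF ab(1,3)] ab by simp
  qed
  have D: "D (q + i) v = D q 0 / 2 ^ i" if "0 \<le> v" "v < 2 ^ i" for i v
    using that
  proof (induction i arbitrary: v)
    case 0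
    then have "v = 0" by simp
    then show ?case by simp
  next
    case (Suc i)
    have "0 \<le> v div 2" "v div 2 < 2 ^ i" using Suc.prems by auto
    then have "D (q + i) (v div 2) = D q 0 / 2 ^ i" by (rule Suc.IH)
    moreover have "v = 2 * (v div 2) \<or> v = 2 * (v div 2) + 1" by presburger
    ultimately show ?case using half[of "q + i" "v div 2"] by auto
  qed
  define s where "s = D q 0 * 2 ^ q"
  have s_pos: "s > 0" using D_pos by (simp add: s_def)
  have Gk: "G (real k / 2 ^ (q + i)) = s * (real k / 2 ^ (q + i))" if "k \<le> 2 ^ i" for k i
    using that
  proof (induction k)
    case (Suc k)
    have "int k < 2 ^ i" using Suc.prems
      by (metis Suc_le_lessD of_nat_less_iff of_nat_numeral of_nat_power)
    then have "D (q + i) (int k) = D q 0 / 2 ^ i" by (intro D) auto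
    then have "G (real (Suc k) / 2 ^ (q + i)) = G (real k / 2 ^ (q + i)) + D q 0 / 2 ^ i"
      by (simp add: D_def add.commute)
    also have "G (real k / 2 ^ (q + i)) = s * (real k / 2 ^ (q + i))"
      using Suc by simp
    finally have "G (real (Suc k) / 2 ^ (q + i)) = s * (real k / 2 ^ (q + i)) + D q 0 / 2 ^ i" .
    moreover have "s * (real (Suc k) / 2 ^ (q + i)) = s * (real k / 2 ^ (q + i)) + D q 0 / 2 ^ i"
      by (simp add: s_def field_simps power_add)
    ultimately show ?case by simp
  qed simp
  have Gs: "G x = s * x" if "0 \<le> x" "x \<le> 1 / 2 ^ q" for x
  proof (rule strict_mono_linear_on_dyadics[OF G_mono _ that])
    fix n k assume n: "q \<le> n" and "real k / 2 ^ n \<le> 1 / 2 ^ q"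
    then have "real k \<le> 2 ^ n / 2 ^ q" by (simp add: field_simps)
    also have "\<dots> = 2 ^ (n - q)" using n by (simp add: power_diff)
    finally have "k \<le> 2 ^ (n - q)" by (metis of_nat_le_iff of_nat_numeral of_nat_power)
    then show "G (real k / 2 ^ n) = s * (real k / 2 ^ n)"
      using Gk[of k "n - q"] n by simp
  qed
  obtain N where N: "1 / 2 ^ N \<le> G (1 / 2 ^ q)"
    using inverse_pow2_le[OF G_pos, of "1 / 2 ^ q"] by auto
  show thesis
  proof (rule that[of "1 / s" N])
    fix x :: real assume x: "0 \<le> x" "x \<le> 1 / 2 ^ N"
    then have "0 \<le> H x" "H x \<le> 1 / 2 ^ q"
      using N H_le[of 0 x] H_le[of x "G (1 / 2 ^ q)"] by auto
    then have "x = s * H x" using Gs[of "H x"] by simp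
    then show "H x = 1 / s * x" using s_pos by (simp add: field_simps)
  qed (use s_pos in auto)
qed

text \<open>
  If an even and an odd interval were similar, so would be their subintervals with equal
  continuations. With continuation \<open>r\<close> these realise both values of the highest digit on which the
  similarity class depends. Here base 2 is essential: the parities of \<open>u\<close> and \<open>u'\<close> exhaust the
  possible values of that digit.
\<close>

lemma parity_of_similar:
  assumes suc: "\<And>m n v w. q \<le> m \<Longrightarrow> q \<le> n \<Longrightarrow> 2 ^ Suc N dvd v - w \<Longrightarrow> similar G m v n w"
    and nv: "q \<le> n" "q \<le> n'" "2 ^ N dvd v - v'" "\<not> similar G n v n' v'"
    and sim: "similar G m u m' u'" "q \<le> m" "q \<le> m'"
  shows "even u \<longleftrightarrow> even u'"
proof (rule ccontr)
  assume parity: "\<not> ?thesis"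
  \<comment> \<open>The \<open>N\<close> low digits shared by \<open>v\<close> and
    \<open>v'\<close>, used as the continuation.\<close>
  define r where "r = v mod 2 ^ N"
  have r: "r = v' mod 2 ^ N" using nv(3) by (simp add: r_def mod_eq_dvd_iff)
  have r_bounds: "0 \<le> r" "r < 2 ^ N" by (auto simp: r_def)
  have v: "v = 2 ^ N * (v div 2 ^ N) + r" and v': "v' = 2 ^ N * (v' div 2 ^ N) + r"
    by (simp add: r_def, simp add: r)
  \<comment> \<open>The low \<open>N + 1\<close> digits of \<open>2 ^ N * a + r\<close> are the
    parity of \<open>a\<close> followed by those of \<open>r\<close>; by \<open>suc\<close> they
    determine the class.\<close>
  have close: "similar G (i + N) (2 ^ N * a + r) j (2 ^ N * b + r)"
    if "even a \<longleftrightarrow> even b" "q \<le> i" "q \<le> j" for a b i j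
  proof (rule suc)
    have "2 * 2 ^ N dvd (a - b) * 2 ^ N" using that(1) by (intro mult_dvd_mono) auto
    then show "2 ^ Suc N dvd 2 ^ N * a + r - (2 ^ N * b + r)" by (simp add: algebra_simps)
  qed (use that in auto)
  \<comment> \<open>Otherwise \<open>v\<close> and \<open>v'\<close> would agree in
    \<open>N + 1\<close> digits and be similar.\<close>
  have diff: "even (v div 2 ^ N) \<longleftrightarrow> odd (v' div 2 ^ N)"
  proof (rule ccontr)
    assume "\<not> ?thesis"
    then have "2 * 2 ^ N dvd (v div 2 ^ N - v' div 2 ^ N) * 2 ^ N" by (intro mult_dvd_mono) auto
    also have "(v div 2 ^ N - v' div 2 ^ N) * 2 ^ N = v - v'"
      using v v' by (simp add: algebra_simps)
    finally show False using suc[of n n' v v'] nv by simp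
  qed
  have sub: "similar G (m + N) (2 ^ N * u + r) (m' + N) (2 ^ N * u' + r)"
    using sim(1) r_bounds by (rule similar_sub)
  have close': "similar G (i + N) (2 ^ N * a + r) j w"
    if "w = 2 ^ N * (w div 2 ^ N) + r" "even a \<longleftrightarrow> even (w div 2 ^ N)" "q \<le> i" "q \<le> j" for a w i j
    using close[OF that(2-4)] unfolding that(1)[symmetric] .
  have "similar G n v n' v'"
  \<comment> \<open>One of \<open>v\<close>, \<open>v'\<close> matches the parity of
    \<open>u\<close>; the other then matches that of \<open>u'\<close>.\<close>
  proof (cases "even u \<longleftrightarrow> even (v div 2 ^ N)")
    case True
    then have "even u' \<longleftrightarrow> even (v' div 2 ^ N)" using diff parity by blast
    with True have "similar G (m + N) (2 ^ N * u + r) n v" "similar G (m' + N) (2 ^ N * u' + r) n' v'"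
      using close'[OF v] close'[OF v'] sim(2,3) nv(1,2) by blast+
    then show ?thesis using sub similar_sym similar_trans by meson
  next
    case False
    then have "even u \<longleftrightarrow> even (v' div 2 ^ N)" "even u' \<longleftrightarrow> even (v div 2 ^ N)"
      using diff parity by blast+
    then have "similar G (m + N) (2 ^ N * u + r) n' v'" "similar G (m' + N) (2 ^ N * u' + r) n v"
      using close'[OF v] close'[OF v'] sim(2,3) nv(1,2) by blast+
    then show ?thesis using sub similar_sym similar_trans by meson
  qed
  then show False using nv by simp
qed


section \<open>Translations conjugated by \<open>H\<close>\<close>

text \<open>At level \<open>m = n + p\<close> the translation adds \<open>2 ^ p\<close> to the left
  endpoint, so it preserves similarity for \<open>H\<close>. Its conjugate is therefore affine with
  slope in \<open>pow2\<close> on the \<open>H\<close>-image of each level \<open>m\<close>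
  interval, and fine grids fit all these pieces.\<close>

lemma eventually_translate_affine:
  "eventually (\<lambda>k. \<forall>u\<in>{0..<2 ^ k::int}. \<exists>l\<ge>q. \<exists>w::int. \<forall>t\<in>{0..1}.
     H (G ((of_int u + t) / 2 ^ k) + 1 / 2 ^ n) = (of_int w + t) / 2 ^ l) sequentially"
proof -
  define m where "m = n + p"
  have "\<exists>e::int. \<forall>t\<in>{0..1}. H ((of_int v + t) / 2 ^ m + 1 / 2 ^ n) - H (of_int v / 2 ^ m + 1 / 2 ^ n) =
      2 powi e * (H ((of_int v + t) / 2 ^ m) - H (of_int v / 2 ^ m))" for v :: int
  proof -
    have shift: "(of_int (v + 2 ^ p) + t) / 2 ^ m = (of_int v + t) / 2 ^ m + 1 / 2 ^ n" for t :: real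
      by (simp add: m_def field_simps power_add)
    have "similar H m (v + 2 ^ p) m v" by (rule H_similar) (auto simp: m_def)
    then show ?thesis
      unfolding similar_def pow2_def using shift shift[of 0] by auto
  qed
  then obtain e :: "int \<Rightarrow> int" where e: "\<And>v t. t \<in> {0..1} \<Longrightarrow>
      H ((of_int v + t) / 2 ^ m + 1 / 2 ^ n) - H (of_int v / 2 ^ m + 1 / 2 ^ n) =
      2 powi e v * (H ((of_int v + t) / 2 ^ m) - H (of_int v / 2 ^ m))"
    by metis
  \<comment> \<open>\<open>k - e v\<close> becomes the level of the image, so it must be at least
    \<open>q\<close>. The next two conditions put the ends of the affine piece on the level
    \<open>k\<close> grid; the last puts the image of its left end on the target grid.\<close>
  define good where "good v k \<longleftrightarrow> int q + e v \<le> int k \<and> 2 ^ k * H (of_int v / 2 ^ m) \<in> \<int> \<and>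
      2 ^ k * H (of_int (v + 1) / 2 ^ m) \<in> \<int> \<and>
      2 ^ nat (int k - e v) * H (of_int v / 2 ^ m + 1 / 2 ^ n) \<in> \<int>" for v k
  have "eventually (good v) sequentially" for v
  proof -
    have "H (of_int v / 2 ^ m + 1 / 2 ^ n) \<in> dyadics"
      by (intro H_dyadics dyadics_add dyadics_frac) (use dyadics_frac[of 1 n] in simp)
    then obtain M where M: "\<And>l. l \<ge> M \<Longrightarrow> 2 ^ l * H (of_int v / 2 ^ m + 1 / 2 ^ n) \<in> \<int>"
      using dyadics_level unfolding eventually_sequentially by blast
    have "eventually (\<lambda>k. nat (int q + int M + \<bar>e v\<bar>) \<le> k) sequentially"
      by (rule eventually_ge_at_top)
    then show ?thesis
      using dyadics_level[OF H_dyadics[OF dyadics_frac[of v m]]]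
        dyadics_level[OF H_dyadics[OF dyadics_frac[of "v + 1" m]]]
    proof eventually_elim
      case (elim k)
      then have "M \<le> nat (int k - e v)" "int q + e v \<le> int k" by linarith+
      then show ?case using elim M unfolding good_def by blast
    qed
  qed
  then have "eventually (\<lambda>k. \<forall>v\<in>{0..<2 ^ m::int}. good v k) sequentially"
    by (intro eventually_ball_finite) auto
  then show ?thesis
  proof eventually_elim
    case (elim k)
    show ?case
    proof
      fix u :: int assume u: "u \<in> {0..<2 ^ k}"
      define v where "v = \<lfloor>2 ^ m * G (of_int u / 2 ^ k)\<rfloor>"
      have "real_of_int u < of_int (2 ^ k)" using u by (simp only: of_int_less_iff) simp
      then have "of_int u / 2 ^ k < (1::real)" by simp
      then have "G (of_int u / 2 ^ k) < 1" using strict_monoD[OF G_mono] G_1 by metis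
      moreover have "0 \<le> G (of_int u / 2 ^ k)" using G_le[of 0 "of_int u / 2 ^ k"] u by simp
      ultimately have "v \<in> {0..<2 ^ m}" by (auto simp: v_def floor_less_iff)
      then have good: "good v k" using elim by blast
      have vl: "of_int v / 2 ^ m \<le> G (of_int u / 2 ^ k)" and vr: "G (of_int u / 2 ^ k) < of_int (v + 1) / 2 ^ m"
        unfolding v_def by (auto simp: field_simps) linarith+
      obtain b where b: "2 ^ k * H (of_int (v + 1) / 2 ^ m) = of_int b"
        using good unfolding good_def by (auto elim: Ints_cases)
      obtain a where a: "2 ^ k * H (of_int v / 2 ^ m) = of_int a"
        using good unfolding good_def by (auto elim: Ints_cases)
      define l where "l = nat (int k - e v)"
      have l: "q \<le> l" and pow: "2 powi e v = (2::real) ^ k / 2 ^ l"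
        using good unfolding good_def l_def
        by (auto simp flip: power_int_of_nat simp: power_int_diff[symmetric])
      obtain d where d: "2 ^ l * H (of_int v / 2 ^ m + 1 / 2 ^ n) = of_int d"
        using good unfolding good_def l_def by (auto elim: Ints_cases)
      have "of_int u / 2 ^ k < H (of_int (v + 1) / 2 ^ m)"
        using strict_monoD[OF mono vr] by simp
      then have "real_of_int u < of_int b" unfolding b[symmetric] by (simp add: field_simps)
      \<comment> \<open>The right end of the piece is a grid point of level \<open>k\<close>, so the
        interval starting at \<open>u\<close> cannot cross it.\<close>
      then have "real_of_int (u + 1) \<le> of_int b" by (simp only: of_int_le_iff of_int_less_iff)
      then have ur: "(of_int u + 1) / 2 ^ k \<le> H (of_int (v + 1) / 2 ^ m)"
        unfolding b[symmetric] by (simp add: field_simps)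
      \<comment> \<open>Counted in grid steps, the left end \<open>a\<close> of the piece goes to
        \<open>d\<close>, hence \<open>u\<close> goes to \<open>d + u - a\<close>.\<close>
      have "H (G ((of_int u + t) / 2 ^ k) + 1 / 2 ^ n) = (of_int (d + u - a) + t) / 2 ^ l"
        if t: "t \<in> {0..1}" for t :: real
      proof -
        define z where "z = (of_int u + t) / 2 ^ k"
        define s where "s = 2 ^ m * G z - of_int v"
        have "z \<le> (of_int u + 1) / 2 ^ k" "of_int u / 2 ^ k \<le> z"
          using t by (auto simp: z_def divide_right_mono)
        then have "G z \<le> of_int (v + 1) / 2 ^ m" "of_int v / 2 ^ m \<le> G z"
          using ur vl G_le by (metis GH order_trans)+
        then have s: "s \<in> {0..1}" by (auto simp: s_def field_simps)
        have Gz: "G z = (of_int v + s) / 2 ^ m" by (simp add: s_def)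
        have "H (G z + 1 / 2 ^ n) = H (of_int v / 2 ^ m + 1 / 2 ^ n) + 2 ^ k / 2 ^ l * (z - H (of_int v / 2 ^ m))"
          using e[OF s, of v] unfolding Gz[symmetric] pow by simp
        also have "\<dots> = (2 ^ l * H (of_int v / 2 ^ m + 1 / 2 ^ n) + (2 ^ k * z - 2 ^ k * H (of_int v / 2 ^ m))) / 2 ^ l"
          by (simp add: field_simps)
        also have "\<dots> = (of_int (d + u - a) + t) / 2 ^ l"
          unfolding a d by (simp add: z_def)
        finally show ?thesis unfolding z_def .
      qed
      then show "\<exists>l\<ge>q. \<exists>w::int. \<forall>t\<in>{0..1}.
          H (G ((of_int u + t) / 2 ^ k) + 1 / 2 ^ n) = (of_int w + t) / 2 ^ l"
        using l by blast
    qed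
  qed
qed

text \<open>
  Breaks are removed by merging siblings: a translation conjugated by \<open>H\<close> preserves similarity
  classes for \<open>G\<close>, hence parity, so it sends an even interval and its odd right neighbour of the
  same length to \<open>[w, w + 1] / 2 ^ l\<close> and \<open>[w', w' + 1] / 2 ^ l'\<close> with \<open>w\<close> even and \<open>w'\<close> odd. Their
  common endpoint forces \<open>l = l'\<close>.
\<close>

lemma translate_affine:
  assumes parity: "\<And>m m' u u'. similar G m u m' u' \<Longrightarrow> q \<le> m \<Longrightarrow> q \<le> m' \<Longrightarrow> even u \<longleftrightarrow> even u'"
    and e: "q \<le> e" and small: "H (G (1 / 2 ^ e) + 1 / 2 ^ n) \<le> 1 / 2 ^ q"
  shows "\<exists>c\<in>pow2. \<forall>z\<in>{0..1 / 2 ^ e}. H (G z + 1 / 2 ^ n) = H (1 / 2 ^ n) + c * z"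
proof -
  define R where "R z = H (G z + 1 / 2 ^ n)" for z
  \<comment> \<open>The bound \<open>2 ^ (k - e)\<close> keeps the intervals inside
    \<open>[0, 1 / 2 ^ e]\<close>; \<open>Q e\<close> concerns that single interval.\<close>
  define Q where "Q k \<longleftrightarrow> (\<forall>u\<in>{0..<2 ^ (k - e)::int}. \<exists>l\<ge>q. \<exists>w::int. \<forall>t\<in>{0..1}.
     R ((of_int u + t) / 2 ^ k) = (of_int w + t) / 2 ^ l)" for k
  have R_mono: "x \<le> y \<Longrightarrow> R x \<le> R y" for x y by (simp add: R_def H_le G_le)
  have "eventually (\<lambda>k. e \<le> k \<and> Q k) sequentially"
    using eventually_translate_affine[of n] eventually_ge_at_top[of e]
  proof eventually_elim
    case (elim k)
    have "(2::int) ^ (k - e) \<le> 2 ^ k" by (intro power_increasing) auto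
    then have "{0..<2 ^ (k - e)} \<subseteq> {0..<2 ^ k :: int}" by auto
    then show ?case using elim unfolding Q_def R_def by blast
  qed
  then obtain K where "e \<le> K" "Q K" by (auto simp: eventually_sequentially)
  then have "Q e"
  \<comment> \<open>The goal \<open>Q e\<close> stays fixed while the level descends: each step
    derives \<open>Q k\<close> from \<open>Q (Suc k)\<close> by merging siblings.\<close>
  proof (induction rule: dec_induct)
    case base
    then show ?case by simp
  next
    case (step k)
    have "Q k" unfolding Q_def
    proof
      fix u :: int assume u: "u \<in> {0..<2 ^ (k - e)}"
      have "2 * u \<in> {0..<2 ^ (Suc k - e)}" "2 * u + 1 \<in> {0..<2 ^ (Suc k - e)}"
        using u step.hyps by (auto simp: Suc_diff_le)
      then obtain l w l' w' where lw: "q \<le> l" "\<And>t. t \<in> {0..1} \<Longrightarrow>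
          R ((of_int (2 * u) + t) / 2 ^ Suc k) = (of_int w + t) / 2 ^ l"
        and lw': "q \<le> l'" "\<And>t. t \<in> {0..1} \<Longrightarrow>
          R ((of_int (2 * u + 1) + t) / 2 ^ Suc k) = (of_int w' + t) / 2 ^ l'"
        using step.prems unfolding Q_def by meson
      \<comment> \<open>\<open>G (R z) - G z\<close> is constant, so an interval and its image are
        similar with factor 1.\<close>
      have sim: "similar G j b (Suc k) a"
        if "\<And>t. t \<in> {0..1} \<Longrightarrow> R ((of_int a + t) / 2 ^ Suc k) = (of_int b + t) / 2 ^ j" for a b j
      proof -
        have GR: "G (R z) = G z + 1 / 2 ^ n" for z by (simp add: R_def)
        show ?thesis unfolding similar_def
          using that[symmetric] that[of 0, symmetric] by (intro bexI[of _ 1]) (auto simp: GR)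
      qed
      have "even w" using parity[OF sim[OF lw(2)]] lw(1) e step.hyps by simp
      have "odd w'" using parity[OF sim[OF lw'(2)]] lw'(1) e step.hyps by simp
      have mid: "(of_int w + 1) / 2 ^ l = (of_int w' / 2 ^ l' :: real)"
        using lw(2)[of 1] lw'(2)[of 0] by simp
      then have "real_of_int ((w + 1) * 2 ^ l') = of_int (w' * 2 ^ l)" by (simp add: field_simps)
      then have eq: "(w + 1) * 2 ^ l' = w' * 2 ^ l" by (simp only: of_int_eq_iff)
      \<comment> \<open>By \<open>eq\<close> the quotient of \<open>w + 1\<close> and
        \<open>w'\<close> is a power of 2, and both are odd.\<close>
      have "l = l'"
      proof (rule ccontr)
        assume "l \<noteq> l'"
        then consider "l < l'" | "l' < l" by linarith
        then show False
        proof cases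
          case 1
          then have "(2::int) ^ l' = 2 ^ l * 2 ^ (l' - l)" by (simp flip: power_add)
          then have "w' = (w + 1) * 2 ^ (l' - l)" using eq by simp
          then show False using \<open>odd w'\<close> 1 by simp
        next
          case 2
          then have "(2::int) ^ l = 2 ^ l' * 2 ^ (l - l')" by (simp flip: power_add)
          then have "w + 1 = w' * 2 ^ (l - l')" using eq by simp
          moreover have "even (w' * 2 ^ (l - l'))" using 2 by simp
          ultimately show False using \<open>even w\<close> by (metis odd_one even_add)
        qed
      qed
      then have w': "w' = w + 1" using mid by simp
      \<comment> \<open>Positivity of \<open>w\<close> and \<open>small\<close> bound
        \<open>l\<close> from below, so the merged interval, of level \<open>l - 1\<close>, still
        has level at least \<open>q\<close>.\<close>
      have "0 < of_int w / (2::real) ^ l"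
      proof -
        have "0 < R 0" by (simp add: R_def H_pos)
        also have "\<dots> \<le> R (of_int (2 * u) / 2 ^ Suc k)" using u by (intro R_mono) simp
        finally show ?thesis using lw(2)[of 0] by simp
      qed
      then have "1 \<le> w" by (simp add: zero_less_divide_iff)
      have "2 / 2 ^ l < (of_int w' + 1) / (2::real) ^ l"
        using \<open>1 \<le> w\<close> w' by (intro divide_strict_right_mono) auto
      also have "\<dots> = R ((of_int (2 * u + 1) + 1) / 2 ^ Suc k)"
        using lw'(2)[of 1] \<open>l = l'\<close> by simp
      also have "\<dots> \<le> R (1 / 2 ^ e)"
      proof (rule R_mono)
        have "real_of_int (u + 1) \<le> of_int (2 ^ (k - e))" using u by (simp only: of_int_le_iff) simp
        also have "\<dots> = 2 ^ k / 2 ^ e"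
          using step.hyps by (simp only: of_int_power of_int_numeral) (simp add: power_diff)
        finally show "(of_int (2 * u + 1) + 1) / 2 ^ Suc k \<le> (1 / 2 ^ e :: real)"
          by (simp add: field_simps)
      qed
      also have "\<dots> \<le> 1 / 2 ^ q" using small by (simp add: R_def)
      finally have "(2::real) ^ Suc q < 2 ^ l" by (simp add: field_simps)
      then have "Suc q < l" by (simp only: power_strict_increasing_iff)
      then obtain j where j: "l = Suc j" "q \<le> j" by (cases l) auto
      obtain b where b: "w = 2 * b" using \<open>even w\<close> by blast
      have "R ((of_int u + t) / 2 ^ k) = (of_int b + t) / 2 ^ j" if t: "t \<in> {0..1}" for t :: real
      proof (cases "t \<le> 1/2")
        case True
        have z: "(of_int u + t) / 2 ^ k = (of_int (2 * u) + 2 * t) / 2 ^ Suc k"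
          by (simp add: field_simps)
        have "R ((of_int u + t) / 2 ^ k) = (of_int w + 2 * t) / 2 ^ l"
          unfolding z using True t by (intro lw(2)) auto
        also have "\<dots> = (of_int b + t) / 2 ^ j" by (simp add: j(1) b field_simps)
        finally show ?thesis .
      next
        case False
        have z: "(of_int u + t) / 2 ^ k = (of_int (2 * u + 1) + (2 * t - 1)) / 2 ^ Suc k"
          by (simp add: field_simps)
        have "R ((of_int u + t) / 2 ^ k) = (of_int w' + (2 * t - 1)) / 2 ^ l'"
          unfolding z using False t by (intro lw'(2)) auto
        also have "\<dots> = (of_int b + t) / 2 ^ j"
          by (simp add: \<open>l = l'\<close>[symmetric] j(1) w' b field_simps)
        finally show ?thesis .
      qed
      then show "\<exists>l\<ge>q. \<exists>w::int. \<forall>t\<in>{0..1}. R ((of_int u + t) / 2 ^ k) = (of_int w + t) / 2 ^ l"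
        using j(2) by blast
    qed
    then show ?case by (rule step.IH)
  qed
  moreover have "0 \<in> {0..<2 ^ (e - e)::int}" by simp
  ultimately obtain l and w :: int where
    "\<forall>t\<in>{0..1}. R ((of_int 0 + t) / 2 ^ e) = (of_int w + t) / 2 ^ l"
    unfolding Q_def by blast
  then have lw: "R (t / 2 ^ e) = (of_int w + t) / 2 ^ l" if "t \<in> {0..1}" for t
    using that by simp
  have "R z = R 0 + 2 ^ e / 2 ^ l * z" if "z \<in> {0..1 / 2 ^ e}" for z
    using lw[of "2 ^ e * z"] lw[of 0] that by (simp add: field_simps)
  then show ?thesis
    by (intro bexI[of _ "2 ^ e / 2 ^ l"]) (auto simp: R_def intro: pow2_divide)
qed

text \<open>If no digit matters, \<open>linear_of_all_similar\<close> applies. Otherwise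
  \<open>c n = 1\<close> makes \<open>H\<close> additive on small multiples of
  \<open>1 / 2 ^ n\<close>. The slope is a unit of Z[1/2] because \<open>H\<close> and
  \<open>G\<close> both preserve dyadic rationals.\<close>

lemma linear_near_0:
  obtains N s where "s \<in> pow2" "\<And>x. 0 \<le> x \<Longrightarrow> x \<le> 1 / 2 ^ N \<Longrightarrow> H x = s * x"
proof -
  have "\<exists>N s. 0 < s \<and> (\<forall>x. 0 \<le> x \<longrightarrow> x \<le> 1 / 2 ^ N \<longrightarrow> H x = s * x)"
  proof -
    define P where "P N \<longleftrightarrow> (\<forall>m n v w. q \<le> m \<longrightarrow> q \<le> n \<longrightarrow> 2 ^ N dvd v - w \<longrightarrow> similar G m v n w)" for N
    have "P q" unfolding P_def using G_similar by blast
    show ?thesis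
    proof (cases "P 0")
      case True
      then have "\<And>m n v w. q \<le> m \<Longrightarrow> q \<le> n \<Longrightarrow> similar G m v n w" by (auto simp: P_def)
      then show ?thesis using linear_of_all_similar by metis
    next
      case False
      \<comment> \<open>\<open>N\<close> low digits do not suffice but \<open>N + 1\<close> do:
        digit \<open>N\<close>, counted from 0, is the highest that matters.\<close>
      then obtain N where N: "\<not> P N" "P (Suc N)"
        using \<open>P q\<close> ex_least_nat_less[of P q] by blast
      then obtain n n' v v' where nv: "q \<le> n" "q \<le> n'" "2 ^ N dvd v - v'" "\<not> similar G n v n' v'"
        unfolding P_def by blast
      have parity: "even u \<longleftrightarrow> even u'" if "similar G m u m' u'" "q \<le> m" "q \<le> m'" for m m' u u'
        by (rule parity_of_similar[OF _ nv that]) (use N(2) in \<open>auto simp: P_def\<close>)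
      \<comment> \<open>One level deeper than \<open>q\<close>, which leaves room below
        \<open>G (1 / 2 ^ q)\<close> for the translation by \<open>1 / 2 ^ n\<close>.\<close>
      define e where "e = Suc q"
      define \<delta> where "\<delta> = G (1 / 2 ^ e)"
      have "\<delta> < G (1 / 2 ^ q)"
        unfolding \<delta>_def e_def by (intro strict_monoD[OF G_mono]) (simp add: field_simps)
      moreover have "0 < \<delta>" by (simp add: \<delta>_def G_pos)
      ultimately obtain M where M: "\<And>n. M \<le> n \<Longrightarrow> 1 / 2 ^ n \<le> min \<delta> (G (1 / 2 ^ q) - \<delta>)"
        using inverse_pow2_le[of "min \<delta> (G (1 / 2 ^ q) - \<delta>)"] by auto
      have "\<exists>c\<in>pow2. \<forall>x\<in>{0..\<delta>}. H (x + 1 / 2 ^ n) = H (1 / 2 ^ n) + c * H x" if n: "M \<le> n" for n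
      proof -
        have "\<delta> + 1 / 2 ^ n \<le> G (1 / 2 ^ q)" using M[OF n] by simp
        then have "H (\<delta> + 1 / 2 ^ n) \<le> H (G (1 / 2 ^ q))" by (simp only: H_le)
        then have "\<exists>c\<in>pow2. \<forall>z\<in>{0..1 / 2 ^ e}. H (G z + 1 / 2 ^ n) = H (1 / 2 ^ n) + c * z"
        proof (intro translate_affine)
          show "even u \<longleftrightarrow> even u'" if "similar G m u m' u'" "q \<le> m" "q \<le> m'" for m m' u u'
            using that by (rule parity)
        qed (simp_all add: \<delta>_def e_def)
        then obtain c where c: "c \<in> pow2" "\<And>z. z \<in> {0..1 / 2 ^ e} \<Longrightarrow> H (G z + 1 / 2 ^ n) = H (1 / 2 ^ n) + c * z"
          by blast
        have "H x \<in> {0..1 / 2 ^ e}" if "x \<in> {0..\<delta>}" for x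
          using that H_le[of 0 x] H_le[of x \<delta>] by (simp add: \<delta>_def)
        then show ?thesis using c(1) c(2)[of "H x" for x] by (intro bexI[of _ c]) auto
      qed
      then obtain c where c: "\<And>n. M \<le> n \<Longrightarrow> c n \<in> pow2"
        "\<And>n x. M \<le> n \<Longrightarrow> x \<in> {0..\<delta>} \<Longrightarrow> H (x + 1 / 2 ^ n) = H (1 / 2 ^ n) + c n * H x"
        by metis
      have in_\<delta>: "1 / 2 ^ n \<in> {0..\<delta>}" if "M \<le> n" for n using M[OF that] by simp
      \<comment> \<open>Evaluates \<open>H (1 / 2 ^ m + 1 / 2 ^ n)\<close> in two ways.\<close>
      have comm: "H (1 / 2 ^ n) * (c m - 1) = H (1 / 2 ^ m) * (c n - 1)" if "M \<le> m" "M \<le> n" for m n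
        using c(2)[OF that(1) in_\<delta>[OF that(2)]] c(2)[OF that(2) in_\<delta>[OF that(1)]]
        by (simp add: algebra_simps)
      have c1: "c n = 1" if n: "M \<le> n" for n
      proof (rule ccontr)
        assume "c n \<noteq> 1"
        define a where "a = H (1 / 2 ^ n)"
        \<comment> \<open>Chosen so that \<open>comm\<close> puts \<open>c m\<close> within 1/4 of 1
          without being 1, against \<open>pow2_gap\<close>.\<close>
        define \<epsilon> where "\<epsilon> = G (a / (4 * \<bar>c n - 1\<bar>))"
        have a: "a > 0" by (simp add: a_def H_pos)
        then have "\<epsilon> > 0" using \<open>c n \<noteq> 1\<close> unfolding \<epsilon>_def by (intro G_pos) simp
        then obtain M' where M': "\<And>m. M' \<le> m \<Longrightarrow> 1 / 2 ^ m \<le> \<epsilon>" using inverse_pow2_le by blast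
        define m where "m = max M M'"
        have m: "M \<le> m" "1 / 2 ^ m \<le> \<epsilon>" using M' by (auto simp: m_def)
        have b: "0 < H (1 / 2 ^ m)" by (simp add: H_pos)
        have "H (1 / 2 ^ m) \<le> H \<epsilon>" using m by (simp only: H_le)
        then have "H (1 / 2 ^ m) * \<bar>c n - 1\<bar> \<le> a / 4"
          using \<open>c n \<noteq> 1\<close> by (simp add: \<epsilon>_def field_simps)
        moreover have "a * \<bar>c m - 1\<bar> = H (1 / 2 ^ m) * \<bar>c n - 1\<bar>"
          using arg_cong[OF comm[OF m(1) n], of abs] a b by (simp add: abs_mult a_def)
        ultimately have "a * \<bar>c m - 1\<bar> \<le> a * (1/4)" by simp
        then have "\<bar>c m - 1\<bar> \<le> 1/4" using a by (simp only: mult_le_cancel_left_pos)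
        moreover have "c m \<noteq> 1" using comm[OF m(1) n] b \<open>c n \<noteq> 1\<close> by auto
        ultimately show False using pow2_gap[OF c(1)[OF m(1)]] by linarith
      qed
      have mult: "H (real k / 2 ^ n) = real k * H (1 / 2 ^ n)" if "M \<le> n" "real k / 2 ^ n \<le> \<delta>" for k n
        using that(2)
      proof (induction k)
        case (Suc k)
        have le: "real k / 2 ^ n \<le> real (Suc k) / 2 ^ n" by (simp add: divide_right_mono)
        then have "real k / 2 ^ n \<in> {0..\<delta>}" using Suc.prems by simp
        then have "H (real k / 2 ^ n + 1 / 2 ^ n) = H (1 / 2 ^ n) + H (real k / 2 ^ n)"
          using c(2) c1 \<open>M \<le> n\<close> by simp
        moreover have "H (real k / 2 ^ n) = real k * H (1 / 2 ^ n)"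
          using Suc.IH Suc.prems le by (meson order_trans)
        moreover have "real (Suc k) / 2 ^ n = real k / 2 ^ n + 1 / 2 ^ n" by (simp add: add_divide_distrib)
        ultimately show ?case by (simp add: distrib_right)
      qed simp
      define s where "s = 2 ^ M * H (1 / 2 ^ M)"
      have "H x = s * x" if "0 \<le> x" "x \<le> 1 / 2 ^ M" for x
      proof (rule strict_mono_linear_on_dyadics[OF mono _ that])
        fix n k assume n: "M \<le> n" and k: "real k / 2 ^ n \<le> 1 / 2 ^ M"
        have pow: "real (2 ^ (n - M)) = 2 ^ n / 2 ^ M"
          using n by (simp only: of_nat_power of_nat_numeral) (simp add: power_diff)
        then have "real (2 ^ (n - M)) / 2 ^ n = 1 / 2 ^ M" by (simp only:) simp
        then have "H (1 / 2 ^ M) = real (2 ^ (n - M)) * H (1 / 2 ^ n)"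
          using mult[OF n, of "2 ^ (n - M)"] in_\<delta>[of M] by simp
        then have "H (1 / 2 ^ n) = s / 2 ^ n" unfolding pow by (simp add: s_def field_simps)
        then show "H (real k / 2 ^ n) = s * (real k / 2 ^ n)"
          using mult[OF n, of k] k in_\<delta>[of M] by simp
      qed
      moreover have "s > 0" by (simp add: s_def H_pos)
      ultimately show ?thesis by blast
    qed
  qed
  then obtain N s where s: "0 < s" and lin: "\<And>x. 0 \<le> x \<Longrightarrow> x \<le> 1 / 2 ^ N \<Longrightarrow> H x = s * x" by blast
  have "s \<in> pow2"
  proof (rule dyadics_unit[OF s])
    have "2 ^ N * H (1 / 2 ^ N) \<in> dyadics"
      using dyadics_frac[of 1 N] by (intro dyadics_mult H_dyadics) (auto intro: dyadics_Ints)
    then show "s \<in> dyadics" using lin[of "1 / 2 ^ N"] by simp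
    \<comment> \<open>So small that \<open>1 / 2 ^ M / s\<close> lies where \<open>H\<close> is
      linear; \<open>G (1 / 2 ^ M)\<close> then exhibits \<open>inverse s\<close>.\<close>
    obtain M where M: "1 / 2 ^ M \<le> s / 2 ^ N" using inverse_pow2_le[of "s / 2 ^ N"] s by auto
    have "H (1 / 2 ^ M / s) = 1 / 2 ^ M"
      using M s by (subst lin) (auto simp: field_simps)
    then have "G (1 / 2 ^ M) = 1 / 2 ^ M / s" by (metis GH)
    moreover have "2 ^ M * G (1 / 2 ^ M) \<in> dyadics"
      using dyadics_frac[of 1 M] by (intro dyadics_mult G_dyadics) (auto intro: dyadics_Ints)
    ultimately have "2 ^ M * (1 / 2 ^ M / s) \<in> dyadics" by simp
    then show "inverse s \<in> dyadics" by (simp add: inverse_eq_divide)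
  qed
  then show thesis using lin by (rule that)
qed

text \<open>Interval \<open>v\<close> of level \<open>p\<close> is similar to interval
  \<open>v mod 2 ^ p\<close> of level \<open>p + N\<close>, which lies in
  \<open>[0, 1 / 2 ^ N]\<close>, where \<open>H\<close> is linear.\<close>

lemma piecewise_affine:
  "\<exists>c\<in>pow2. \<forall>t\<in>{0..1}. H ((of_int v + t) / 2 ^ p) - H (of_int v / 2 ^ p) = c * t"
proof -
  obtain N s where s: "s \<in> pow2" and lin: "\<And>x. 0 \<le> x \<Longrightarrow> x \<le> 1 / 2 ^ N \<Longrightarrow> H x = s * x"
    using linear_near_0 by blast
  define w where "w = v mod 2 ^ p"
  define m where "m = p + N"
  have w: "0 \<le> w" "w < 2 ^ p" by (auto simp: w_def)
  have "similar H p v m w"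
    by (rule H_similar) (simp_all add: m_def w_def minus_mod_eq_mult_div)
  then obtain c where c: "c \<in> pow2" "\<And>t. t \<in> {0..1} \<Longrightarrow> H ((of_int v + t) / 2 ^ p) - H (of_int v / 2 ^ p) =
      c * (H ((of_int w + t) / 2 ^ m) - H (of_int w / 2 ^ m))"
    by (auto simp: similar_def)
  have "real_of_int (w + 1) \<le> of_int (2 ^ p)" using w by (simp only: of_int_le_iff)
  then have Hw: "H ((of_int w + t) / 2 ^ m) = s * ((of_int w + t) / 2 ^ m)" if "t \<in> {0..1}" for t
  proof (intro lin)
    have "of_int w + t \<le> 2 ^ p" using \<open>real_of_int (w + 1) \<le> of_int (2 ^ p)\<close> that by simp
    then have "(of_int w + t) / 2 ^ m \<le> 2 ^ p / 2 ^ m" by (rule divide_right_mono) simp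
    also have "\<dots> = 1 / 2 ^ N" by (simp add: m_def power_add)
    finally show "(of_int w + t) / 2 ^ m \<le> 1 / 2 ^ N" .
  qed (use that w in auto)
  have "H ((of_int v + t) / 2 ^ p) - H (of_int v / 2 ^ p) = c * s / 2 ^ m * t"
    if "t \<in> {0..1}" for t
  proof -
    have "H ((of_int v + t) / 2 ^ p) - H (of_int v / 2 ^ p) =
        c * (s * ((of_int w + t) / 2 ^ m) - s * (of_int w / 2 ^ m))"
      using c(2)[OF that] Hw[OF that] Hw[of 0] by simp
    also have "\<dots> = c * s / 2 ^ m * t" by (simp add: field_simps)
    finally show ?thesis .
  qed
  moreover have "c * s / 2 ^ m \<in> pow2" using c s by (intro pow2_divide pow2_mult) auto
  ultimately show ?thesis by blast
qed

end

section \<open>Maps of the circle and their lifts\<close>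

lemma circle_of_cases: obtains t where "p = circle_of t"
  by (metis Quotient3_abs_rep Quotient3_circle)

lemma circle_of_add_int [simp]: "circle_of (x + of_int k) = circle_of x"
  by (simp add: circle_of_eq_iff)

lemma circle_of_in_dyadic_points_iff: "circle_of x \<in> dyadic_points \<longleftrightarrow> x \<in> dyadics"
proof
  assume "circle_of x \<in> dyadic_points"
  then obtain a b :: int where "circle_of x = circle_of (of_int a * 2 powi b)"
    by (auto simp: dyadic_points_def)
  then have "x - of_int a * 2 powi b \<in> dyadics" by (simp add: circle_of_eq_iff dyadics_Ints)
  moreover have "of_int a * 2 powi b \<in> dyadics"
    by (intro dyadics_mult dyadics_Ints pow2_dyadics) auto
  ultimately show "x \<in> dyadics" using dyadics_add by fastforce
next
  assume "x \<in> dyadics"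
  then obtain v n where "x = of_int v / 2 ^ n" by (rule dyadicsE)
  then have "x = of_int v * 2 powi (- int n)" by (simp add: power_int_minus field_simps)
  then show "circle_of x \<in> dyadic_points" unfolding dyadic_points_def by blast
qed

lemma continuous_on_circle_of: "continuous_on A circle_of"
  by (rule continuous_on_subset[of UNIV])
    (auto simp: continuous_on_open_vimage open_circle_def)

lemma isCont_circle_of: "isCont circle_of t"
  using continuous_on_circle_of[of UNIV] by (simp add: continuous_on_eq_continuous_at)

lemma open_circle_of_image:
  assumes "open U"
  shows "open (circle_of ` U)"
proof -
  have "circle_of -` (circle_of ` U) = (\<Union>k::int. (+) (of_int k) ` U)"
  proof safe
    fix x u assume "u \<in> U" "circle_of x = circle_of u"
    then obtain k where "x - u = of_int k" by (auto simp: circle_of_eq_iff elim: Ints_cases)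
    then have "x = of_int k + u" by simp
    then show "x \<in> (\<Union>k::int. (+) (of_int k) ` U)" using \<open>u \<in> U\<close> by blast
  next
    fix k :: int and u assume "u \<in> U"
    have "circle_of (of_int k + u) = circle_of u" by (simp add: circle_of_eq_iff)
    then show "of_int k + u \<in> circle_of -` circle_of ` U" using \<open>u \<in> U\<close> by simp
  qed
  moreover have "open \<dots>" using assms by (intro open_UN ballI open_translation)
  ultimately show ?thesis by (simp add: open_circle_def)
qed

text \<open>Points are closed because the integers are closed in the line. \<open>T21I\<close> uses
  that finite sets of circle points are closed.\<close>

instance circle :: t1_space
proof
  fix p q :: circle assume "p \<noteq> q"
  obtain t where t: "q = circle_of t" by (rule circle_of_cases)
  have "circle_of -` (- {q}) = (\<lambda>x. x - t) -` (- \<int>)"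
    by (auto simp: t circle_of_eq_iff)
  moreover have "open \<dots>" by (intro open_vimage continuous_intros) (simp add: open_Compl)
  ultimately have "open (- {q})" by (simp add: open_circle_def)
  then show "\<exists>U. open U \<and> p \<in> U \<and> q \<notin> U" using \<open>p \<noteq> q\<close> by blast
qed

lemma compact_UNIV_circle: "compact (UNIV :: circle set)"
proof -
  have "circle_of ` {0..1} = UNIV"
  proof safe
    fix p
    obtain t where t: "p = circle_of t" by (rule circle_of_cases)
    then have "p = circle_of (frac t)" by (simp add: circle_of_eq_iff frac_def)
    moreover have "frac t \<in> {0..1}" using frac_lt_1[of t] by (simp add: less_imp_le)
    ultimately show "p \<in> circle_of ` {0..1}" by blast
  qed simp
  then show ?thesis using compact_continuous_image[OF continuous_on_circle_of, of "{0..1}"] by simp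
qed

text \<open>An infinite set would accumulate somewhere on the compact circle.\<close>

lemma finite_of_sparse_in_circle:
  fixes A :: "circle set"
  assumes "A sparse_in UNIV"
  shows "finite A"
  using Heine_Borel_imp_Bolzano_Weierstrass[OF compact_UNIV_circle, of A] assms
  by (auto simp: sparse_in_open)

section \<open>Slopes and affine pieces of lifts\<close>

text \<open>\<open>has_slope\<close> allows any local representative at any preimage of the point.
  Up to an integer shift of the argument, it differs from the given lift by an integer valued
  function continuous at \<open>t\<close>, which is constant nearby.\<close>

lemma DERIV_of_has_slope:
  assumes lift: "\<And>x. f (circle_of x) = circle_of (F x)"
    and cont: "isCont F t" and slope: "has_slope f D (circle_of t)"
  shows "(F has_real_derivative D) (at t)"
proof -
  obtain u g where u: "circle_of u = circle_of t" "\<forall>\<^sub>F s in nhds u. f (circle_of s) = circle_of (g s)"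
      "(g has_real_derivative D) (at u)"
    using slope by (auto simp: has_slope_def)
  obtain n :: int where n: "u = t + of_int n"
    using u(1) by (auto simp: circle_of_eq_iff algebra_simps elim!: Ints_cases)
  define d where "d s = F s - g (s + of_int n)" for s
  have g: "((\<lambda>s. g (s + of_int n)) has_real_derivative D) (at t)"
    using u(3) unfolding n by (simp add: DERIV_shift)
  have "filterlim (\<lambda>s. s + of_int n) (nhds (t + of_int n)) (nhds t)"
    by (intro tendsto_intros filterlim_ident)
  from eventually_compose_filterlim[OF u(2)[unfolded n] this]
  have ev: "\<forall>\<^sub>F s in nhds t. d s \<in> \<int>"
    by eventually_elim (simp add: lift circle_of_eq_iff d_def)
  then have dt: "d t \<in> \<int>" using eventually_nhds_x_imp_x by blast
  have "isCont d t"
    unfolding d_def using cont DERIV_isCont[OF g] by (intro continuous_intros)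
  then have "filterlim d (nhds (d t)) (nhds t)"
    by (simp add: isCont_def tendsto_at_iff_tendsto_nhds)
  then have "\<forall>\<^sub>F s in nhds t. dist (d s) (d t) < 1" by (rule tendstoD) simp
  with ev have "\<forall>\<^sub>F s in nhds t. F s = g (s + of_int n) + d t"
  proof eventually_elim
    case (elim s)
    then have "d s = d t" using dt Ints_eq_abs_less1[of "d s" "d t"] by (simp add: dist_real_def)
    then show ?case by (simp add: d_def)
  qed
  moreover have "((\<lambda>s. g (s + of_int n) + d t) has_real_derivative D) (at t)"
    using DERIV_add[OF g DERIV_const] by simp
  ultimately show ?thesis by (rule iffD2[OF DERIV_cong_ev[OF refl _ refl]])
qed

lemma has_slope_of_DERIV:
  assumes "\<And>x. f (circle_of x) = circle_of (F x)" "(F has_real_derivative D) (at t)"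
  shows "has_slope f D (circle_of t)"
  unfolding has_slope_def using assms(2)
  by (intro exI[of _ t] exI[of _ F]) (simp add: assms(1))

text \<open>By compactness the breaks are finite in number, so a single dyadic grid contains them
  all. Between grid points the slope is continuous with values in \<open>pow2\<close>, hence
  constant.\<close>

lemma T21_bar_affine:
  assumes f: "(UNIV, f) \<in> T21_bar"
    and cont: "\<And>x. isCont F x" and lift: "\<And>x. f (circle_of x) = circle_of (F x)"
  obtains N :: nat where "\<And>v::int. \<exists>c\<in>pow2. \<forall>x\<in>{of_int v / 2 ^ N..(of_int v + 1) / 2 ^ N}.
    \<forall>y\<in>{of_int v / 2 ^ N..(of_int v + 1) / 2 ^ N}. F x - F y = c * (x - y)"
proof -
  define B where "B = breaks UNIV f"
  have "finite B" "B \<subseteq> dyadic_points" and slopes: "slopes_powers_of_2 UNIV f"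
    using f finite_of_sparse_in_circle by (auto simp: T21_bar_def B_def)
  have "\<exists>t. p = circle_of t" for p by (rule circle_of_cases[of p]) blast
  then obtain r where r: "\<And>p. p = circle_of (r p)" by metis
  have "\<forall>\<^sub>F n in sequentially. \<forall>p\<in>B. 2 ^ n * r p \<in> \<int>"
    using \<open>finite B\<close> \<open>B \<subseteq> dyadic_points\<close> r circle_of_in_dyadic_points_iff
    by (intro eventually_ball_finite ballI dyadics_level) (metis subsetD)+
  then obtain N where N: "\<And>p. p \<in> B \<Longrightarrow> 2 ^ N * r p \<in> \<int>"
    by (auto simp: eventually_sequentially)
  have B: "2 ^ N * t \<in> \<int>" if "circle_of t \<in> B" for t
  proof -
    have "circle_of t = circle_of (r (circle_of t))" by (rule r)
    then have "t - r (circle_of t) \<in> \<int>" by (simp add: circle_of_eq_iff)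
    then have "2 ^ N * (t - r (circle_of t)) + 2 ^ N * r (circle_of t) \<in> \<int>"
      using N[OF that] by (intro Ints_add) auto
    also have "2 ^ N * (t - r (circle_of t)) + 2 ^ N * r (circle_of t) = 2 ^ N * t"
      by (simp add: right_diff_distrib)
    finally show ?thesis .
  qed
  define g where "g t = slope f (circle_of t)" for t
  have "\<exists>c\<in>pow2. \<forall>x\<in>{of_int v / 2 ^ N..(of_int v + 1) / 2 ^ N}.
    \<forall>y\<in>{of_int v / 2 ^ N..(of_int v + 1) / 2 ^ N}. F x - F y = c * (x - y)" for v :: int
  proof -
    define a b where "a = real_of_int v / 2 ^ N" and "b = (real_of_int v + 1) / 2 ^ N"
    have "a < b" by (simp add: a_def b_def divide_strict_right_mono)
    have notB: "circle_of t \<notin> B" if "t \<in> {a<..<b}" for t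
    proof
      assume "circle_of t \<in> B"
      then obtain k where "2 ^ N * t = of_int k" using B by (auto elim: Ints_cases)
      then have "of_int v < (of_int k::real)" "of_int k < of_int v + (1::real)"
        using that by (auto simp: a_def b_def field_simps)
      then have "of_int v < (of_int k::real)" "of_int k < (of_int (v + 1)::real)" by simp_all
      then show False unfolding of_int_less_iff by linarith
    qed
    have hs: "has_slope f (g t) (circle_of t)" if "t \<in> {a<..<b}" for t
      using notB[OF that] slope_eq unfolding g_def B_def breaks_def has_some_slope_def by blast
    have der: "(F has_real_derivative g t) (at t)" if "t \<in> {a<..<b}" for t
      using DERIV_of_has_slope[OF lift cont hs[OF that]] .
    have g2: "g t \<in> pow2" if "t \<in> {a<..<b}" for t
      using slopes hs[OF that] unfolding slopes_powers_of_2_def pow2_def by blast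
    have "isCont g t" if t: "t \<in> {a<..<b}" for t
    proof -
      have "(slope f \<longlongrightarrow> g t) (at (circle_of t) within {q. has_some_slope f q})"
        using notB[OF t] unfolding g_def B_def breaks_def by simp
      \<comment> \<open>\<open>breaks\<close> takes its limits on the circle. To pull them back to
        the line, points near \<open>t\<close> must not be identified with \<open>t\<close>, hence
        the ball of radius 1.\<close>
      moreover have "filterlim circle_of (at (circle_of t) within {q. has_some_slope f q}) (at t)"
        unfolding filterlim_at
      proof
        have "\<forall>\<^sub>F s in at t. s \<in> {a<..<b}"
          using t by (intro eventually_at_in_open') auto
        moreover have "\<forall>\<^sub>F s in at t. s \<in> ball t 1 - {t}"
          by (intro eventually_at_in_open) auto
        ultimately show "\<forall>\<^sub>F s in at t. circle_of s \<in> {q. has_some_slope f q} \<and> circle_of s \<noteq> circle_of t"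
        proof eventually_elim
          case (elim s)
          have "s - t \<notin> \<int>"
            using elim(2) Ints_nonzero_abs_less1[of "s - t"]
            by (auto simp: dist_real_def abs_minus_commute)
          then show ?case using hs[OF elim(1)] by (auto simp: has_some_slope_def circle_of_eq_iff)
        qed
        show "circle_of \<midarrow>t\<rightarrow> circle_of t" using isCont_circle_of[of t] by (simp add: isCont_def)
      qed
      ultimately show ?thesis unfolding isCont_def g_def by (rule filterlim_compose)
    qed
    then have "continuous_on {a<..<b} g" by (simp add: continuous_at_imp_continuous_on)
    \<comment> \<open>A power of 2 other than \<open>g x\<close> differs from it by at least
      \<open>g x / 2\<close>.\<close>
    moreover have "\<exists>e>0. \<forall>y. y \<in> {a<..<b} \<and> g y \<noteq> g x \<longrightarrow> e \<le> norm (g y - g x)"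
      if x: "x \<in> {a<..<b}" for x
    proof (intro exI[of _ "g x / 2"] conjI allI impI)
      fix y assume y: "y \<in> {a<..<b} \<and> g y \<noteq> g x"
      have "1/2 \<le> \<bar>g y / g x - 1\<bar>"
        using y g2[OF x] pow2_pos[OF g2[OF x]] g2[of y] by (intro pow2_gap pow2_divide) auto
      also have "\<bar>g y / g x - 1\<bar> = \<bar>g y - g x\<bar> / g x"
      proof -
        have "g y / g x - 1 = (g y - g x) / g x"
          using pow2_pos[OF g2[OF x]] by (simp add: diff_divide_distrib)
        then show ?thesis using pow2_pos[OF g2[OF x]] by (simp add: abs_divide)
      qed
      finally show "g x / 2 \<le> norm (g y - g x)"
        using pow2_pos[OF g2[OF x]] by (simp add: field_simps)
    qed (use pow2_pos[OF g2[OF x]] in simp)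
    ultimately have "g constant_on {a<..<b}"
      by (intro continuous_discrete_range_constant) auto
    then obtain c where c: "\<And>t. t \<in> {a<..<b} \<Longrightarrow> g t = c" by (auto simp: constant_on_def)
    have "c \<in> pow2" using c[of "(a + b) / 2"] g2[of "(a + b) / 2"] \<open>a < b\<close> by simp
    have const: "F x - c * x = F a - c * a" if "x \<in> {a..b}" for x
    proof (rule DERIV_isconst2[OF \<open>a < b\<close>])
      show "continuous_on {a..b} (\<lambda>x. F x - c * x)"
        using cont by (intro continuous_intros continuous_at_imp_continuous_on) auto
      show "((\<lambda>x. F x - c * x) has_real_derivative 0) (at t)" if "a < t" "t < b" for t
        using der[of t] c[of t] that by (auto intro!: derivative_eq_intros)
    qed (use that in auto)
    have "F x - F y = c * (x - y)" if "x \<in> {a..b}" "y \<in> {a..b}" for x y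
      using const[OF that(1)] const[OF that(2)] by (simp add: algebra_simps)
    then show ?thesis using \<open>c \<in> pow2\<close> unfolding a_def b_def by blast
  qed
  then show thesis by (rule that)
qed

text \<open>The level \<open>p\<close> grid is finite modulo 1, and it contains all breaks because
  the slope is constant on open cells.\<close>

lemma T21I:
  assumes homeo: "circle_homeomorphism h"
    and mono: "strict_mono H" and cont: "\<And>x. isCont H x"
    and lift: "\<And>x. h (circle_of x) = circle_of (H x)"
    and dyad: "\<And>x. x \<in> dyadics \<Longrightarrow> H x \<in> dyadics"
    and affine: "\<And>v::int. \<exists>c\<in>pow2. \<forall>t\<in>{0..1}. H ((of_int v + t) / 2 ^ p) - H (of_int v / 2 ^ p) = c * t"
  shows "h \<in> T21"
proof -
  obtain c where c: "\<And>v. c v \<in> pow2" "\<And>v t. t \<in> {0..1} \<Longrightarrow>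
      H ((of_int v + t) / 2 ^ p) - H (of_int v / 2 ^ p) = c v * t"
    using affine by metis
  define C where "C v = 2 ^ p * c v" for v
  have C: "C v \<in> pow2" for v using c(1) by (simp add: C_def pow2_mult)
  have aff: "H x - H y = C v * (x - y)"
    if "x \<in> {of_int v / 2 ^ p..(of_int v + 1) / 2 ^ p}" "y \<in> {of_int v / 2 ^ p..(of_int v + 1) / 2 ^ p}" for v x y
  proof -
    have "H z = H (of_int v / 2 ^ p) + c v * (2 ^ p * z - of_int v)"
      if "z \<in> {of_int v / 2 ^ p..(of_int v + 1) / 2 ^ p}" for z
      using c(2)[of "2 ^ p * z - of_int v" v] that by (auto simp: field_simps)
    from this[OF that(1)] this[OF that(2)] show ?thesis by (simp add: C_def algebra_simps)
  qed
  define B where "B = range (\<lambda>v::int. circle_of (of_int v / 2 ^ p))"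
  have "B \<subseteq> (\<lambda>v::int. circle_of (of_int v / 2 ^ p)) ` {0..<2 ^ p}"
  proof -
    have "circle_of (of_int v / 2 ^ p) = circle_of (of_int (v mod 2 ^ p) / 2 ^ p)" for v :: int
      by (subst frac_mod_pow) simp
    moreover have "v mod 2 ^ p \<in> {0..<2 ^ p}" for v :: int by simp
    ultimately show ?thesis unfolding B_def by blast
  qed
  then have "finite B" by (rule finite_subset) simp
  have "B \<subseteq> dyadic_points" by (auto simp: B_def circle_of_in_dyadic_points_iff)
  have slope_near: "has_slope h (C v) (circle_of s)"
    if s: "s \<in> {of_int v / 2 ^ p<..<(of_int v + 1) / 2 ^ p}" for s v
  proof (rule has_slope_of_DERIV[where F = H, rule_format], rule lift)
    have "\<forall>\<^sub>F x in nhds s. x \<in> {of_int v / 2 ^ p<..<(of_int v + 1) / 2 ^ p}"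
      using s by (intro eventually_nhds_in_open) auto
    then have "\<forall>\<^sub>F x in nhds s. H x = H s + C v * (x - s)"
    proof eventually_elim
      case (elim x)
      then have "H x - H s = C v * (x - s)" using s by (intro aff) auto
      then show ?case by simp
    qed
    moreover have "((\<lambda>x. H s + C v * (x - s)) has_real_derivative C v) (at s)"
      by (auto intro!: derivative_eq_intros)
    ultimately show "(H has_real_derivative C v) (at s)"
      by (rule iffD2[OF DERIV_cong_ev[OF refl _ refl]])
  qed
  have "breaks UNIV h \<subseteq> B"
  proof
    fix q assume q: "q \<in> breaks UNIV h"
    show "q \<in> B"
    proof (rule ccontr)
      assume "q \<notin> B"
      obtain t where t: "q = circle_of t" by (rule circle_of_cases)
      define v where "v = \<lfloor>2 ^ p * t\<rfloor>"
      have "of_int v \<noteq> 2 ^ p * t"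
      proof
        assume "of_int v = 2 ^ p * t"
        then have "t = of_int v / 2 ^ p" by simp
        then show False using \<open>q \<notin> B\<close> t by (auto simp: B_def)
      qed
      moreover have "of_int v \<le> 2 ^ p * t" by (simp add: v_def)
      ultimately have "of_int v < 2 ^ p * t" by simp
      moreover have "2 ^ p * t < of_int v + 1" by (simp add: v_def)
      ultimately
      have tv: "t \<in> {of_int v / 2 ^ p<..<(of_int v + 1) / 2 ^ p}" by (simp add: field_simps)
      define W where "W = circle_of ` {of_int v / 2 ^ p<..<(of_int v + 1) / 2 ^ p}"
      have "open W" "q \<in> W" using tv t by (auto simp: W_def intro: open_circle_of_image)
      have W: "slope h r = C v" if "r \<in> W" for r
        using that slope_near slope_eq by (auto simp: W_def)
      have "\<forall>\<^sub>F r in at q within {r \<in> UNIV. has_some_slope h r}. slope h r = slope h q"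
        unfolding eventually_at_topological
        using \<open>open W\<close> \<open>q \<in> W\<close> by (intro exI[of _ W]) (simp add: W)
      then have "(slope h \<longlongrightarrow> slope h q) (at q within {r \<in> UNIV. has_some_slope h r})"
        by (rule tendsto_eventually)
      then show False
        using q slope_near[OF tv] t by (auto simp: breaks_def has_some_slope_def)
    qed
  qed
  have "piecewise_linear UNIV h"
    unfolding piecewise_linear_def
  proof (intro conjI ballI)
    show "continuous_on UNIV h"
      using homeo by (auto simp: circle_homeomorphism_def homeomorphism_def)
    fix q :: circle
    have "open (- (B - {q}))" using \<open>finite B\<close> by (intro open_Compl finite_imp_closed) auto
    then show "\<exists>N. open N \<and> q \<in> N \<and> N \<subseteq> UNIV \<and> breaks UNIV h \<inter> N \<subseteq> {q}"
      using \<open>breaks UNIV h \<subseteq> B\<close> by (intro exI[of _ "- (B - {q})"]) auto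
  qed
  moreover have "orientation_preserving h"
    unfolding orientation_preserving_def
    using mono cont lift by (auto intro!: exI[of _ H] continuous_at_imp_continuous_on)
  moreover have "slopes_powers_of_2 UNIV h"
    unfolding slopes_powers_of_2_def
  proof (intro ballI allI impI)
    fix q D assume D: "has_slope h D q"
    obtain t where t: "q = circle_of t" by (rule circle_of_cases)
    define v where "v = \<lfloor>2 ^ p * t\<rfloor>"
    have "of_int v \<le> 2 ^ p * t" "2 ^ p * t < of_int v + 1" by (auto simp: v_def)
    then have tv: "of_int v / 2 ^ p \<le> t" "t < (of_int v + 1) / 2 ^ p" by (auto simp: field_simps)
    have "(H has_real_derivative D) (at t)"
      using DERIV_of_has_slope[OF lift cont] D t by blast
    \<comment> \<open>A slope may exist at a grid point too. The right-hand difference quotient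
      treats all points alike: just to the right of \<open>t\<close> it equals
      \<open>C v\<close>.\<close>
    then have "((\<lambda>y. (H y - H t) / (y - t)) \<longlongrightarrow> D) (at_right t)"
      unfolding has_field_derivative_iff by (rule filterlim_mono) (auto simp: at_le)
    moreover have "\<forall>\<^sub>F y in at_right t. y \<in> {t<..<(of_int v + 1) / 2 ^ p}"
      using tv(2) by (rule eventually_at_right_real)
    then have "\<forall>\<^sub>F y in at_right t. (H y - H t) / (y - t) = C v"
      by eventually_elim (use aff[of _ v t] tv in auto)
    then have "((\<lambda>y. (H y - H t) / (y - t)) \<longlongrightarrow> C v) (at_right t)" by (rule tendsto_eventually)
    ultimately have "D = C v" by (rule tendsto_unique[rotated]) simp
    then show "\<exists>k::int. D = 2 powi k" using C[of v] by (auto simp: pow2_def)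
  qed
  moreover have "discrete B"
  proof (rule discreteI)
    fix x assume "x \<in> B"
    have "open (- (B - {x}))" using \<open>finite B\<close> by (intro open_Compl finite_imp_closed) auto
    then show "x isolated_in B"
      using \<open>x \<in> B\<close> unfolding isolated_in_def by (intro conjI exI[of _ "- (B - {x})"]) auto
  qed
  moreover have "h ` dyadic_points \<subseteq> dyadic_points"
  proof safe
    fix q assume "q \<in> dyadic_points"
    moreover obtain t where "q = circle_of t" by (rule circle_of_cases)
    ultimately show "h q \<in> dyadic_points" by (simp add: lift circle_of_in_dyadic_points_iff dyad)
  qed
  ultimately show ?thesis
    using homeo \<open>breaks UNIV h \<subseteq> B\<close> \<open>B \<subseteq> dyadic_points\<close> unfolding T21_def by blast
qed

section \<open>Normalized lifts and dyadic rationals\<close>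

text \<open>Subtracting its integer value at 0 normalizes an increasing lift. That its degree is 1
  follows from injectivity of \<open>h\<close>.\<close>

lemma circle_lift:
  assumes homeo: "circle_homeomorphism h" and "orientation_preserving h"
    and h0: "h (circle_of 0) = circle_of 0"
  obtains H where "\<And>x. isCont H x" "strict_mono H" "\<And>x. h (circle_of x) = circle_of (H x)"
    "H 0 = 0" "\<And>x. H (x + 1) = H x + 1"
proof -
  obtain H0 where H0: "continuous_on UNIV H0" "strict_mono H0" "\<And>x. h (circle_of x) = circle_of (H0 x)"
    using assms by (auto simp: orientation_preserving_def)
  have "inj h" using homeo unfolding circle_homeomorphism_def homeomorphism_def by (metis UNIV_I injI)
  define H where "H x = H0 x - H0 0" for x
  have "circle_of (H0 0) = circle_of 0" using H0(3)[of 0] h0 by simp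
  then obtain k where k: "H0 0 = of_int k" by (auto simp: circle_of_eq_iff elim: Ints_cases)
  have lift: "h (circle_of x) = circle_of (H x)" for x
    using H0(3)[of x] circle_of_add_int[of "H x" k] by (simp add: H_def k)
  have cont: "continuous_on UNIV H" unfolding H_def by (intro continuous_intros H0)
  have mono: "strict_mono H" using H0(2) by (auto simp: H_def strict_mono_def)
  have H_0: "H 0 = 0" by (simp add: H_def)
  \<comment> \<open>The degree, constant because it is continuous and integer valued.\<close>
  define d where "d x = H (x + 1) - H x" for x
  have d_int: "d x \<in> \<int>" for x
  proof -
    have "circle_of (H (x + 1)) = circle_of (H x)"
      using circle_of_add_int[of x 1] by (simp flip: lift)
    then show ?thesis by (simp add: circle_of_eq_iff d_def)
  qed
  have "continuous_on UNIV d"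
    unfolding d_def by (intro continuous_intros continuous_on_compose2[OF cont]) auto
  then have "d constant_on UNIV"
  proof (rule continuous_discrete_range_constant[rotated])
    show "\<exists>e>0. \<forall>y. y \<in> UNIV \<and> d y \<noteq> d x \<longrightarrow> e \<le> norm (d y - d x)" for x
      using d_int Ints_nonzero_abs_ge1[of "d y - d x" for y] by (intro exI[of _ 1]) auto
  qed simp
  then obtain c where c: "\<And>x. d x = c" by (auto simp: constant_on_def)
  have H1: "H 1 = c" using c[of 0] H_0 by (simp add: d_def)
  then have "c > 0" using strict_monoD[OF mono, of 0 1] H_0 by simp
  then have "1 \<le> c" using d_int[of 0] c[of 0] by (auto elim!: Ints_cases)
  \<comment> \<open>At such an \<open>x\<close> the map \<open>h\<close> takes its value at 0, so
    injectivity leaves only \<open>x = 1\<close>.\<close>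
  then obtain x where x: "0 \<le> x" "x \<le> 1" "H x = 1"
    using IVT'[of H 0 1 1] H_0 H1 continuous_on_subset[OF cont] by auto
  then have "h (circle_of x) = h (circle_of 0)"
    by (simp add: lift H_0 circle_of_eq_iff)
  then have "x \<in> \<int>" using \<open>inj h\<close> by (simp add: inj_eq circle_of_eq_iff)
  then obtain z where z: "x = of_int z" by (auto elim: Ints_cases)
  moreover have "x \<noteq> 0" using x H_0 by auto
  ultimately have "x = 1" using x by simp
  then have "c = 1" using x H1 by simp
  show thesis
  proof (rule that[of H])
    show "isCont H x" for x using cont by (simp add: continuous_on_eq_continuous_at)
    show "H (x + 1) = H x + 1" for x using c[of x] \<open>c = 1\<close> by (simp add: d_def)
  qed (use mono lift H_0 in auto)
qed

text \<open>Being affine on cells with slopes in \<open>pow2\<close>, \<open>A\<close> also reflects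
  dyadic rationals; \<open>n\<close> applications of \<open>A\<close> turn the value at
  \<open>v / 2 ^ n\<close> into the integer \<open>v\<close>.\<close>

lemma preserves_dyadics:
  fixes \<phi> A :: "real \<Rightarrow> real"
  assumes int: "\<And>v::int. \<phi> (of_int v) = of_int v" and conj: "\<And>x. \<phi> (2 * x) = A (\<phi> x)"
    and A: "\<And>x. x \<in> dyadics \<Longrightarrow> A x \<in> dyadics"
    and affine: "\<And>v::int. \<exists>c\<in>pow2. \<forall>x\<in>{of_int v / 2 ^ N..(of_int v + 1) / 2 ^ N}.
       \<forall>y\<in>{of_int v / 2 ^ N..(of_int v + 1) / 2 ^ N}. A x - A y = c * (x - y)"
    and x: "x \<in> dyadics"
  shows "\<phi> x \<in> dyadics"
proof -
  have reflect: "z \<in> dyadics" if z: "A z \<in> dyadics" for z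
  proof -
    define v where "v = \<lfloor>2 ^ N * z\<rfloor>"
    have "of_int v \<le> 2 ^ N * z" "2 ^ N * z \<le> of_int v + 1" by (auto simp: v_def)
    then have zv: "z \<in> {of_int v / 2 ^ N..(of_int v + 1) / 2 ^ N}" by (simp add: field_simps)
    have vv: "of_int v / 2 ^ N \<in> {of_int v / 2 ^ N..(of_int v + 1) / (2::real) ^ N}"
      by (simp add: divide_right_mono)
    obtain c where c: "c \<in> pow2" "A z - A (of_int v / 2 ^ N) = c * (z - of_int v / 2 ^ N)"
      using affine[of v] zv vv by blast
    then have "z = inverse c * (A z - A (of_int v / 2 ^ N)) + of_int v / 2 ^ N"
      using pow2_pos[OF c(1)] unfolding c(2) by (simp flip: mult.assoc)
    moreover have "\<dots> \<in> dyadics"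
      using pow2_dyadics[OF pow2_inverse[OF c(1)]] z
      by (intro dyadics_add dyadics_mult dyadics_diff A[OF dyadics_frac] dyadics_frac)
    ultimately show ?thesis by simp
  qed
  have "\<phi> (of_int v / 2 ^ n) \<in> dyadics" for v n
  proof (induction n)
    case 0
    then show ?case by (simp add: int dyadics_Ints)
  next
    case (Suc n)
    have "A (\<phi> (of_int v / 2 ^ Suc n)) = \<phi> (of_int v / 2 ^ n)"
      unfolding conj[symmetric] by simp
    then show ?case using Suc reflect by metis
  qed
  then show ?thesis using x by (metis dyadicsE)
qed

section \<open>Assembling the proof\<close>

theorem corollary2p1:
  fixes h :: "circle \<Rightarrow> circle"
  assumes "circle_homeomorphism h"
    and "orientation_preserving h"
    and "h (circle_of 0) = circle_of 0"
    and "(UNIV, h \<circ> nu2 \<circ> inv h) \<in> T21_bar"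
    and "(UNIV, inv h \<circ> nu2 \<circ> h) \<in> T21_bar"
  shows "h \<in> T21"
proof -
  obtain H where contH: "\<And>x. isCont H x" and mono: "strict_mono H"
    and lift: "\<And>x. h (circle_of x) = circle_of (H x)"
    and H0: "H 0 = 0" and H_per: "\<And>x. H (x + 1) = H x + 1"
    using circle_lift[OF assms(1-3)] by blast
  have H_int: "H (of_int k) = of_int k" for k :: int
    using add_of_int_of_add_1[of H 0 k, OF H_per] H0 by simp
  have "\<exists>x. H x = y" for y
  proof -
    have "\<exists>x. of_int \<lfloor>y\<rfloor> \<le> x \<and> x \<le> of_int (\<lfloor>y\<rfloor> + 1) \<and> H x = y"
    proof (rule IVT')
      show "H (of_int \<lfloor>y\<rfloor>) \<le> y" "y \<le> H (of_int (\<lfloor>y\<rfloor> + 1))" unfolding H_int by linarith+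
      show "continuous_on {of_int \<lfloor>y\<rfloor>..of_int (\<lfloor>y\<rfloor> + 1)} H"
        using contH by (simp add: continuous_at_imp_continuous_on)
    qed simp
    then show ?thesis by blast
  qed
  then obtain G where HG: "\<And>y. H (G y) = y" by metis
  have GH: "G (H x) = x" for x using HG strict_mono_eq[OF mono] by metis
  have G_mono: "strict_mono G" by (rule strict_monoI) (metis HG mono strict_mono_less)
  have G_per: "G (x + 1) = G x + 1" for x using H_per[of "G x"] HG GH by metis
  have G_int: "G (of_int k) = of_int k" for k :: int by (metis GH H_int)
  have contG: "isCont G y" for y
    using isCont_inverse_function[of 1 "G y" G H] contH by (simp add: GH HG)
  have "inj h" using assms(1) unfolding circle_homeomorphism_def homeomorphism_def by (metis UNIV_I injI)
  then have inv_lift: "inv h (circle_of y) = circle_of (G y)" for y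
    by (metis HG inv_f_f lift)
  have nu2: "nu2 (circle_of x) = circle_of (2 * x)" for x by (simp add: nu2.abs_eq)
  define F where "F x = H (2 * G x)" for x
  define K where "K x = G (2 * H x)" for x
  have F_lift: "(h \<circ> nu2 \<circ> inv h) (circle_of x) = circle_of (F x)"
    and K_lift: "(inv h \<circ> nu2 \<circ> h) (circle_of x) = circle_of (K x)" for x
    by (simp_all add: F_def K_def lift inv_lift nu2)
  have contF: "isCont F x" and contK: "isCont K x" for x
    unfolding F_def K_def
    by (rule isCont_o2[of _ "\<lambda>x. 2 * _ x"]; use contH contG in \<open>auto intro!: continuous_intros\<close>)+
  obtain N where N: "\<And>v::int. \<exists>c\<in>pow2. \<forall>x\<in>{of_int v / 2 ^ N..(of_int v + 1) / 2 ^ N}.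
    \<forall>y\<in>{of_int v / 2 ^ N..(of_int v + 1) / 2 ^ N}. F x - F y = c * (x - y)"
    using T21_bar_affine[OF assms(4) contF F_lift] by blast
  obtain M where M: "\<And>v::int. \<exists>c\<in>pow2. \<forall>x\<in>{of_int v / 2 ^ M..(of_int v + 1) / 2 ^ M}.
    \<forall>y\<in>{of_int v / 2 ^ M..(of_int v + 1) / 2 ^ M}. K x - K y = c * (x - y)"
    using T21_bar_affine[OF assms(5) contK K_lift] by blast
  have F_dyad: "F x \<in> dyadics" if "x \<in> dyadics" for x
  proof -
    have "(h \<circ> nu2 \<circ> inv h) ` (dyadic_points \<inter> UNIV) \<subseteq> dyadic_points"
      using assms(4) by (simp add: T21_bar_def)
    then show ?thesis using that F_lift circle_of_in_dyadic_points_iff by (metis IntI UNIV_I image_subset_iff)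
  qed
  have K_dyad: "K x \<in> dyadics" if "x \<in> dyadics" for x
  proof -
    have "(inv h \<circ> nu2 \<circ> h) ` (dyadic_points \<inter> UNIV) \<subseteq> dyadic_points"
      using assms(5) by (simp add: T21_bar_def)
    then show ?thesis using that K_lift circle_of_in_dyadic_points_iff by (metis IntI UNIV_I image_subset_iff)
  qed
  have HF: "H (2 * x) = F (H x)" and GK: "G (2 * x) = K (G x)" for x
    by (simp_all add: F_def K_def HG GH)
  have H_dyad: "H x \<in> dyadics" if "x \<in> dyadics" for x
    using H_int HF F_dyad N that by (rule preserves_dyadics)
  have G_dyad: "G x \<in> dyadics" if "x \<in> dyadics" for x
    using G_int GK K_dyad M that by (rule preserves_dyadics)
  \<comment> \<open>The cell ends of \<open>F\<close> are pulled back by \<open>G\<close>, so this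
    uses that \<open>G\<close> preserves dyadic rationals; for \<open>q\<close> the roles are
    exchanged.\<close>
  obtain p where p: "\<And>m n v w. p \<le> m \<Longrightarrow> p \<le> n \<Longrightarrow> 2 ^ p dvd v - w \<Longrightarrow> similar H m v n w"
    using eventually_similar[OF mono HG H_per HF G_dyad N] by blast
  obtain q where q: "\<And>m n v w. q \<le> m \<Longrightarrow> q \<le> n \<Longrightarrow> 2 ^ q dvd v - w \<Longrightarrow> similar G m v n w"
    using eventually_similar[OF G_mono GH G_per GK H_dyad M] by blast
  interpret dyadic_conjugacy H G p q
    using mono HG GH H0 H_int[of 1] H_dyad G_dyad p q by unfold_locales auto
  show ?thesis
    using assms(1) mono contH lift H_dyad piecewise_affine by (rule T21I)
qed

end
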